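(* Let $(\varGamma,C)$ be a split-step SUSYQW with anisotropic coin $C$. Then $Q_{\epsilon_+}$ has closed range if and only if $|p|\ne|a(\sharp)|$ for every $\sharp\in\{\mathrm L,\mathrm R\}$ for which $b(\sharp)\ne0$ (i.e. for which $C(\sharp)$ is not diagonal).
   Context: Let $L$ be the left shift $(L\Psi)(x)=\Psi(x+1)$ on $\ell^2(\mathbb Z)$. A split-step SUSYQW is $\varGamma=\begin{pmatrix} p & qL\\ \overline{q}L^* & -p\end{pmatrix}$, $C=\begin{pmatrix} a_1 & \overline{b}\\ b & a_2\end{pmatrix}$ on $\ell^2(\mathbb Z)\oplus\ell^2(\mathbb Z)$ with $p\in\mathbb R$, $q\in\mathbb C\setminus\{0\}$, $p^2+|q|^2=1$, $\theta=\operatorname{Arg}q$, real sequences $a_1,a_2$ and complex sequence $b$ on $\mathbb Z$ (as multiplication operators) with $a_j(x)^2+|b(x)|^2=1$, $b(x)(a_1(x)+a_2(x))=0$. $C$ is anisotropic if $C(\mathrm L)=\lim_{x\to-\infty}C(x)$ and $C(\mathrm R)=\lim_{x\to+\infty}C(x)$ exist, where $C(x)=\begin{pmatrix} a_1(x)&\overline{b(x)}\\ b(x)&a_2(x)\end{pmatrix}$; $a_j(\sharp),b(\sharp)$ denote the entries of $C(\sharp)$. When $b(\sharp)\neq0$, necessarily $a_1(\sharp)=-a_2(\sharp)=:a(\sharp)$ with $a(\sharp)^2+|b(\sharp)|^2=1$. $Q_{\epsilon_+}$ is the operator on $\ell^2(\mathbb Z)$ given by $-2iQ_{\epsilon_+}=(1+p)e^{i\theta}Lb-(1-p)e^{-i\theta}\overline{b}L^*+|q|(a_2(\cdot+1)-a_1)$.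 *)

theory Defs
  imports "HOL-Analysis.Analysis"
begin

definition l2 :: "(int \<Rightarrow> complex) set" where
  "l2 = {f. (\<lambda>x. (cmod (f x))\<^sup>2) summable_on UNIV}"

definition l2norm :: "(int \<Rightarrow> complex) \<Rightarrow> real" where
  "l2norm f = sqrt (\<Sum>\<^sub>\<infinity>x. (cmod (f x))\<^sup>2)"

definition l2_closed :: "(int \<Rightarrow> complex) set \<Rightarrow> bool" where
  "l2_closed S \<longleftrightarrow>
     (\<forall>g\<in>l2. (\<forall>e>0. \<exists>h\<in>S. l2norm (\<lambda>x. h x - g x) < e) \<longrightarrow> g \<in> S)"

definition Lshift :: "(int \<Rightarrow> complex) \<Rightarrow> int \<Rightarrow> complex" where
  "Lshift f x = f (x + 1)"

definition Lshift_adj :: "(int \<Rightarrow> complex) \<Rightarrow> int \<Rightarrow> complex" where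
  "Lshift_adj f x = f (x - 1)"

definition Qeps_plus ::
  "real \<Rightarrow> complex \<Rightarrow> (int \<Rightarrow> real) \<Rightarrow> (int \<Rightarrow> real) \<Rightarrow> (int \<Rightarrow> complex)
     \<Rightarrow> (int \<Rightarrow> complex) \<Rightarrow> int \<Rightarrow> complex" where
  "Qeps_plus p q a1 a2 b f x =
     (complex_of_real (1 + p) * cis (Arg q) * Lshift (\<lambda>y. b y * f y) x
      - complex_of_real (1 - p) * cis (- Arg q) * cnj (b x) * Lshift_adj f x
      + complex_of_real (cmod q * (a2 (x + 1) - a1 x)) * f x) / (- 2 * \<i>)"

end

theory Submission
  imports Defs
begin

text \<open>
  \<open>Q\<close> is a tridiagonal operator whose coefficients converge at both ends, and on a side
  with \<open>b(\<sharp>) \<noteq> 0\<close> the symbol of the limit operator has a zero on the unit circle iff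
  \<open>\<bar>p\<bar> = \<bar>a(\<sharp>)\<bar>\<close>. If \<open>b(\<sharp>) = 0\<close>, then either the limit operator is a
  nonzero scalar, or \<open>b\<close> and the diagonal vanish identically near that end, because
  \<open>b (a\<^sub>1 + a\<^sub>2) = 0\<close>.

  Without zeros the limit operators factor into first order ones that are bounded below. Hence
  \<open>Q\<close> is bounded below on sequences supported far out, where it does not vanish, and its range
  is a closed subspace plus a finite-dimensional one.

  If there is a zero, truncated plane waves give disjointly supported unit vectors \<open>f\<^sub>k\<close>
  with \<open>\<parallel>Q f\<^sub>k\<parallel> \<le> 2\<^bsup>-k\<^esup>\<close>. For every infinite set of indices \<open>k\<close>, the image
  of \<open>\<Sum>\<^sub>k f\<^sub>k\<close> lies in the closure of the range. If it always lay in the range,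
  these sums would be square summable near that end up to solutions of a second order recurrence,
  which three disjoint index sets contradict.
\<close>

section \<open>Square summable sequences\<close>

lemma L2_set_le_l2norm:
  assumes "f \<in> l2" "finite F"
  shows "L2_set (\<lambda>x. cmod (f x)) F \<le> l2norm f"
  using assms unfolding L2_set_def l2norm_def l2_def
  by (auto intro!: finite_sum_le_infsum)

text \<open>The norm is the supremum of the finite Euclidean norms \<open>L2_set\<close>, so
  domination and Minkowski's inequality carry over from finite sums through this criterion.\<close>

lemma l2I:
  assumes "\<And>F. finite F \<Longrightarrow> L2_set (\<lambda>x. cmod (f x)) F \<le> B"
  shows "f \<in> l2" and "l2norm f \<le> B"
proof -
  have B: "0 \<le> B" using assms[of "{}"] by simp
  have le: "(\<Sum>x\<in>F. (cmod (f x))\<^sup>2) \<le> B\<^sup>2" if "finite F" for F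
    using assms[OF that] B unfolding L2_set_def by (simp add: real_le_lsqrt sqrt_le_D)
  have s: "(\<lambda>x. (cmod (f x))\<^sup>2) summable_on UNIV"
    by (rule nonneg_bdd_above_summable_on) (auto intro!: bdd_aboveI[of _ "B\<^sup>2"] le)
  then show "f \<in> l2" by (simp add: l2_def)
  have "(\<Sum>\<^sub>\<infinity>x. (cmod (f x))\<^sup>2) \<le> B\<^sup>2"
    by (rule infsum_le_finite_sums[OF s]) (auto intro: le)
  then show "l2norm f \<le> B"
    unfolding l2norm_def using B real_le_lsqrt by blast
qed

lemma l2norm_nonneg [simp]: "0 \<le> l2norm f"
  unfolding l2norm_def by (simp add: infsum_nonneg)

lemma cmod_le_l2norm: "f \<in> l2 \<Longrightarrow> cmod (f x) \<le> l2norm f"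
  using L2_set_le_l2norm[of f "{x}"] by (simp add: L2_set_def)

lemma l2_zero [simp]: "(\<lambda>x. 0) \<in> l2" and l2norm_zero [simp]: "l2norm (\<lambda>x. 0) = 0"
  by (auto simp: l2_def l2norm_def)

lemma
  assumes "g \<in> l2" "\<And>x. cmod (f x) \<le> cmod (g x)"
  shows l2_dominated: "f \<in> l2" and l2norm_dominated: "l2norm f \<le> l2norm g"
proof -
  have "L2_set (\<lambda>x. cmod (f x)) F \<le> l2norm g" if "finite F" for F
    using L2_set_mono[of F "\<lambda>x. cmod (f x)" "\<lambda>x. cmod (g x)"] L2_set_le_l2norm[OF assms(1) that] assms(2)
    by force
  from l2I[OF this] show "f \<in> l2" "l2norm f \<le> l2norm g" by auto
qed

lemma
  assumes "f \<in> l2" "g \<in> l2"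
  shows l2_add: "(\<lambda>x. f x + g x) \<in> l2"
    and l2norm_add: "l2norm (\<lambda>x. f x + g x) \<le> l2norm f + l2norm g"
proof -
  have "L2_set (\<lambda>x. cmod (f x + g x)) F \<le> l2norm f + l2norm g" if "finite F" for F
  proof -
    have "L2_set (\<lambda>x. cmod (f x + g x)) F \<le> L2_set (\<lambda>x. cmod (f x) + cmod (g x)) F"
      by (intro L2_set_mono norm_triangle_ineq norm_ge_zero)
    also have "\<dots> \<le> L2_set (\<lambda>x. cmod (f x)) F + L2_set (\<lambda>x. cmod (g x)) F"
      by (rule L2_set_triangle_ineq)
    also have "\<dots> \<le> l2norm f + l2norm g"
      using assms that by (intro add_mono L2_set_le_l2norm)
    finally show ?thesis .
  qed
  from l2I[OF this] show "(\<lambda>x. f x + g x) \<in> l2" "l2norm (\<lambda>x. f x + g x) \<le> l2norm f + l2norm g"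
    by auto
qed

lemma l2norm_scale: "l2norm (\<lambda>x. c * f x) = cmod c * l2norm f"
  unfolding l2norm_def
  by (simp add: norm_mult power_mult_distrib infsum_cmult_right' real_sqrt_mult)

lemma l2_scale: "f \<in> l2 \<Longrightarrow> (\<lambda>x. c * f x) \<in> l2"
  unfolding l2_def by (simp add: norm_mult power_mult_distrib summable_on_cmult_right)

lemma l2_diff: "f \<in> l2 \<Longrightarrow> g \<in> l2 \<Longrightarrow> (\<lambda>x. f x - g x) \<in> l2"
  using l2_add[OF _ l2_scale[of g "-1"], of f] by simp

lemma l2norm_diff: "f \<in> l2 \<Longrightarrow> g \<in> l2 \<Longrightarrow> l2norm (\<lambda>x. f x - g x) \<le> l2norm f + l2norm g"
  using l2norm_add[OF _ l2_scale[of g "-1"], of f] l2norm_scale[of "-1" g] by simp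

lemma l2norm_diff_ge:
  "f \<in> l2 \<Longrightarrow> g \<in> l2 \<Longrightarrow> l2norm f - l2norm g \<le> l2norm (\<lambda>x. f x - g x)"
  using l2norm_add[OF l2_diff[of f g], of g] by simp

lemma l2norm_commute: "l2norm (\<lambda>x. f x - g x) = l2norm (\<lambda>x. g x - f x)"
  by (simp add: l2norm_def norm_minus_commute)

lemma
  assumes "bij (\<pi> :: int \<Rightarrow> int)"
  shows l2_reindex: "(\<lambda>x. f (\<pi> x)) \<in> l2 \<longleftrightarrow> f \<in> l2"
    and l2norm_reindex: "l2norm (\<lambda>x. f (\<pi> x)) = l2norm f"
  using summable_on_reindex_bij_betw[OF assms, of "\<lambda>x. (cmod (f x))\<^sup>2"]
    infsum_reindex_bij_betw[OF assms, of "\<lambda>x. (cmod (f x))\<^sup>2"]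
  by (simp_all add: l2_def l2norm_def)

lemma l2_finite_support:
  assumes "finite F" "\<And>x. x \<notin> F \<Longrightarrow> f x = 0"
  shows "f \<in> l2" and "(l2norm f)\<^sup>2 = (\<Sum>x\<in>F. (cmod (f x))\<^sup>2)"
proof -
  have "((\<lambda>x. (cmod (f x))\<^sup>2) has_sum (\<Sum>x\<in>F. (cmod (f x))\<^sup>2)) UNIV"
    by (rule has_sum_finite_neutralI) (use assms in auto)
  then show "f \<in> l2" "(l2norm f)\<^sup>2 = (\<Sum>x\<in>F. (cmod (f x))\<^sup>2)"
    by (auto simp: l2_def l2norm_def infsumI summable_on_def sum_nonneg)
qed

text \<open>A Fatou argument: on each finite set the Euclidean norm passes to the limit and keeps
  the bound \<open>B\<close>.\<close>

lemma l2_pointwise_limit: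
  assumes "\<And>n. f n \<in> l2" "\<And>n. l2norm (f n) \<le> B" "\<And>x. (\<lambda>n. f n x) \<longlonglongrightarrow> g x"
  shows "g \<in> l2"
proof (rule l2I(1))
  fix F :: "int set" assume F: "finite F"
  have "(\<lambda>n. L2_set (\<lambda>x. cmod (f n x)) F) \<longlonglongrightarrow> L2_set (\<lambda>x. cmod (g x)) F"
    unfolding L2_set_def by (intro tendsto_intros assms)
  then show "L2_set (\<lambda>x. cmod (g x)) F \<le> B"
    by (rule LIMSEQ_le_const2)
      (use order_trans[OF L2_set_le_l2norm[OF assms(1) F] assms(2)] in blast)
qed

section \<open>Tridiagonal operators\<close>

definition tridiag ::
  "(int \<Rightarrow> complex) \<Rightarrow> (int \<Rightarrow> complex) \<Rightarrow> (int \<Rightarrow> complex) \<Rightarrow> (int \<Rightarrow> complex) \<Rightarrow> int \<Rightarrow> complex"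
  where "tridiag \<alpha> \<beta> \<gamma> f x = \<alpha> x * f (x + 1) + \<beta> x * f (x - 1) + \<gamma> x * f x"

lemma tridiag_diff:
  "tridiag \<alpha> \<beta> \<gamma> (\<lambda>x. f x - g x) = (\<lambda>x. tridiag \<alpha> \<beta> \<gamma> f x - tridiag \<alpha> \<beta> \<gamma> g x)"
  by (auto simp: tridiag_def algebra_simps)

lemma tridiag_add:
  "tridiag \<alpha> \<beta> \<gamma> (\<lambda>x. f x + g x) = (\<lambda>x. tridiag \<alpha> \<beta> \<gamma> f x + tridiag \<alpha> \<beta> \<gamma> g x)"
  by (auto simp: tridiag_def algebra_simps)

lemma tridiag_scale:
  "tridiag \<alpha> \<beta> \<gamma> (\<lambda>x. c * f x) = (\<lambda>x. c * tridiag \<alpha> \<beta> \<gamma> f x)"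
  by (auto simp: tridiag_def algebra_simps)

lemma bij_int_shift: "bij (\<lambda>x::int. x + k)"
  by (rule bij_betw_byWitness[where f' = "\<lambda>x. x - k"]) auto

lemma bij_int_uminus: "bij (uminus :: int \<Rightarrow> int)"
  by (rule bij_betw_byWitness[where f' = uminus]) auto

lemma
  shows l2_shift: "(\<lambda>x. f (x + k)) \<in> l2 \<longleftrightarrow> f \<in> l2"
    and l2norm_shift: "l2norm (\<lambda>x. f (x + k)) = l2norm f"
  using l2_reindex[OF bij_int_shift] l2norm_reindex[OF bij_int_shift] by auto

lemma
  shows l2_shift_minus: "(\<lambda>x. f (x - k)) \<in> l2 \<longleftrightarrow> f \<in> l2"
    and l2norm_shift_minus: "l2norm (\<lambda>x. f (x - k)) = l2norm f"
  using l2_shift[of f "-k"] l2norm_shift[of f "-k"] by auto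

lemma
  assumes "g \<in> l2" "\<And>x. cmod (f x) \<le> C * cmod (g x)" "0 \<le> C"
  shows l2_bounded_multiple: "f \<in> l2" and l2norm_bounded_multiple: "l2norm f \<le> C * l2norm g"
  using l2_dominated[OF l2_scale[OF assms(1), of "complex_of_real C"], of f]
    l2norm_dominated[OF l2_scale[OF assms(1), of "complex_of_real C"], of f] assms(2,3)
  by (auto simp: l2norm_scale norm_mult)

text \<open>The coefficients are bounded only in places where they meet the support of
  \<open>f\<close>. A perturbation that is small merely far out is thereby small on sequences
  supported there.\<close>

lemma
  assumes "f \<in> l2" "0 \<le> C"
    and "\<And>x. f (x + 1) \<noteq> 0 \<Longrightarrow> cmod (\<alpha> x) \<le> C"
    and "\<And>x. f (x - 1) \<noteq> 0 \<Longrightarrow> cmod (\<beta> x) \<le> C"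
    and "\<And>x. f x \<noteq> 0 \<Longrightarrow> cmod (\<gamma> x) \<le> C"
  shows l2_tridiag: "tridiag \<alpha> \<beta> \<gamma> f \<in> l2"
    and l2norm_tridiag_le: "l2norm (tridiag \<alpha> \<beta> \<gamma> f) \<le> 3 * C * l2norm f"
proof -
  have le: "cmod (u * v) \<le> C * cmod v" if "v \<noteq> 0 \<Longrightarrow> cmod u \<le> C" for u v
    using that by (cases "v = 0") (auto simp: norm_mult intro: mult_right_mono)
  have f1: "(\<lambda>x. f (x + 1)) \<in> l2" and f2: "(\<lambda>x. f (x - 1)) \<in> l2"
    using assms(1) by (simp_all add: l2_shift l2_shift_minus)
  note b1 = l2_bounded_multiple[OF f1, of "\<lambda>x. \<alpha> x * f (x + 1)" C]
    l2norm_bounded_multiple[OF f1, of "\<lambda>x. \<alpha> x * f (x + 1)" C]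
  note b2 = l2_bounded_multiple[OF f2, of "\<lambda>x. \<beta> x * f (x - 1)" C]
    l2norm_bounded_multiple[OF f2, of "\<lambda>x. \<beta> x * f (x - 1)" C]
  note b3 = l2_bounded_multiple[OF assms(1), of "\<lambda>x. \<gamma> x * f x" C]
    l2norm_bounded_multiple[OF assms(1), of "\<lambda>x. \<gamma> x * f x" C]
  have m: "(\<lambda>x. \<alpha> x * f (x + 1)) \<in> l2" "(\<lambda>x. \<beta> x * f (x - 1)) \<in> l2" "(\<lambda>x. \<gamma> x * f x) \<in> l2"
    using b1(1) b2(1) b3(1) le assms by auto
  have n: "l2norm (\<lambda>x. \<alpha> x * f (x + 1)) \<le> C * l2norm f" "l2norm (\<lambda>x. \<beta> x * f (x - 1)) \<le> C * l2norm f"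
    "l2norm (\<lambda>x. \<gamma> x * f x) \<le> C * l2norm f"
    using b1(2) b2(2) b3(2) le assms by (auto simp: l2norm_shift l2norm_shift_minus)
  show "tridiag \<alpha> \<beta> \<gamma> f \<in> l2"
    using l2_add[OF l2_add[OF m(1,2)] m(3)] by (simp add: tridiag_def[abs_def])
  show "l2norm (tridiag \<alpha> \<beta> \<gamma> f) \<le> 3 * C * l2norm f"
    using l2norm_add[OF l2_add[OF m(1,2)] m(3)] l2norm_add[OF m(1,2)] n
    by (simp add: tridiag_def[abs_def])
qed

section \<open>Closedness of images of sequences with prescribed support\<close>

definition l2_on :: "int set \<Rightarrow> (int \<Rightarrow> complex) set" where
  "l2_on A = {f \<in> l2. \<forall>x. x \<notin> A \<longrightarrow> f x = 0}"

lemma l2_on_diff: "f \<in> l2_on A \<Longrightarrow> g \<in> l2_on A \<Longrightarrow> (\<lambda>x. f x - g x) \<in> l2_on A"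
  by (auto simp: l2_on_def l2_diff)

lemma l2_closed_obtain_seq:
  assumes "\<forall>e>0. \<exists>h\<in>T ` S. l2norm (\<lambda>x. h x - g x) < e"
  obtains f where "\<And>n::nat. f n \<in> S" "\<And>n. l2norm (\<lambda>x. T (f n) x - g x) < 1 / real (Suc n)"
proof -
  have "\<exists>f\<in>S. l2norm (\<lambda>x. T f x - g x) < 1 / real (Suc n)" for n
    using assms[rule_format, of "1 / real (Suc n)"] by auto
  then show ?thesis using that by metis
qed

lemma Cauchy_of_inverse_bound:
  fixes X :: "nat \<Rightarrow> complex"
  assumes "\<And>m n. norm (X m - X n) \<le> C * (1 / real (Suc m) + 1 / real (Suc n))" "0 \<le> C"
  shows "Cauchy X"
proof (rule CauchyI)
  fix e :: real assume e: "0 < e"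
  have "(\<lambda>n. 2 * C * (1 / real (Suc n))) \<longlonglongrightarrow> 2 * C * 0"
    by (intro tendsto_intros LIMSEQ_inverse_real_of_nat[unfolded inverse_eq_divide])
  then have "\<forall>\<^sub>F n in sequentially. 2 * C * (1 / real (Suc n)) < e"
    using e by (intro order_tendstoD(2)) auto
  then obtain N where N: "2 * C * (1 / real (Suc N)) < e"
    by (auto simp: eventually_sequentially)
  have "norm (X m - X n) < e" if "m \<ge> N" "n \<ge> N" for m n
  proof -
    have "1 / real (Suc m) + 1 / real (Suc n) \<le> 2 * (1 / real (Suc N))"
      using frac_le[of 1 1 "real (Suc N)" "real (Suc m)"] frac_le[of 1 1 "real (Suc N)" "real (Suc n)"] that
      by simp
    then have "C * (1 / real (Suc m) + 1 / real (Suc n)) \<le> C * (2 * (1 / real (Suc N)))"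
      using assms(2) by (rule mult_left_mono)
    then show ?thesis using assms(1)[of m n] N by (simp only: mult.assoc mult.left_commute[of 2])
  qed
  then show "\<exists>M. \<forall>m\<ge>M. \<forall>n\<ge>M. norm (X m - X n) < e" by blast
qed

locale bounded_tridiag =
  fixes \<alpha> \<beta> \<gamma> :: "int \<Rightarrow> complex" and K :: real
  assumes bounded: "\<And>x. cmod (\<alpha> x) \<le> K" "\<And>x. cmod (\<beta> x) \<le> K" "\<And>x. cmod (\<gamma> x) \<le> K"
begin

abbreviation "T \<equiv> tridiag \<alpha> \<beta> \<gamma>"

lemma K_nonneg: "0 \<le> K"
  using bounded(1)[of 0] norm_ge_zero order_trans by blast

lemma T_l2: "f \<in> l2 \<Longrightarrow> T f \<in> l2"
  using l2_tridiag bounded K_nonneg by blast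

text \<open>If \<open>T (f n)\<close> approaches \<open>g\<close>, the lower bound makes
  \<open>f n\<close> Cauchy in norm, hence pointwise convergent. Pointwise limits suffice to
  identify \<open>g\<close>, because each value of \<open>T h\<close> involves three values of
  \<open>h\<close>.\<close>

lemma closed_image_bounded_below:
  assumes below: "\<And>f. f \<in> l2_on A \<Longrightarrow> l2norm f \<le> C * l2norm (T f)" and C: "0 \<le> C"
  shows "l2_closed (T ` l2_on A)"
  unfolding l2_closed_def
proof (intro ballI impI)
  fix g assume g: "g \<in> l2" and approx: "\<forall>e>0. \<exists>h\<in>T ` l2_on A. l2norm (\<lambda>x. h x - g x) < e"
  obtain f where f: "\<And>n::nat. f n \<in> l2_on A"
    and lim: "\<And>n. l2norm (\<lambda>x. T (f n) x - g x) < 1 / real (Suc n)"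
    using l2_closed_obtain_seq[OF approx] by blast
  have fl2: "f n \<in> l2" for n using f by (auto simp: l2_on_def)
  have Tg: "(\<lambda>x. T (f n) x - g x) \<in> l2" for n by (intro l2_diff T_l2 fl2 g)
  have diff: "l2norm (\<lambda>x. f m x - f n x) \<le> C * (1 / real (Suc m) + 1 / real (Suc n))" for m n
  proof -
    have "l2norm (T (\<lambda>x. f m x - f n x)) \<le> 1 / real (Suc m) + 1 / real (Suc n)"
      using l2norm_diff[OF Tg[of m] Tg[of n]] lim[of m] lim[of n] by (simp add: tridiag_diff)
    then show ?thesis
      using below[OF l2_on_diff[OF f f], of m n] C mult_left_mono order_trans by blast
  qed
  have "Cauchy (\<lambda>n. f n x)" for x
    using C diff cmod_le_l2norm[OF l2_diff[OF fl2 fl2]] order_trans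
    by (intro Cauchy_of_inverse_bound[of _ C]) blast+
  then have "\<exists>l. (\<lambda>n. f n x) \<longlonglongrightarrow> l" for x
    using Cauchy_convergent convergent_def by blast
  then obtain h where h: "\<And>x. (\<lambda>n. f n x) \<longlonglongrightarrow> h x" by metis
  \<comment> \<open>Comparison with \<open>f 0\<close> bounds the norms uniformly, which puts the
    pointwise limit into \<open>l2\<close>.\<close>
  have "l2norm (f n) \<le> l2norm (f 0) + C * 2" for n
  proof -
    have "1 / real (Suc n) \<le> 1" by simp
    then have "C * (1 / real (Suc n) + 1 / real (Suc 0)) \<le> C * 2"
      using C by (intro mult_left_mono) auto
    then show ?thesis using l2norm_diff_ge[OF fl2[of n] fl2[of 0]] diff[of n 0] by linarith
  qed
  then have hl2: "h \<in> l2" using l2_pointwise_limit[OF fl2 _ h] by blast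
  have "h x = 0" if "x \<notin> A" for x
    using h[of x] f that LIMSEQ_unique[OF _ tendsto_const, of 0] by (auto simp: l2_on_def)
  then have hA: "h \<in> l2_on A" using hl2 by (auto simp: l2_on_def)
  have "T h x = g x" for x
  proof (rule LIMSEQ_unique)
    show "(\<lambda>n. T (f n) x) \<longlonglongrightarrow> T h x"
      unfolding tridiag_def by (intro tendsto_intros h)
    have "(\<lambda>n. T (f n) x - g x) \<longlonglongrightarrow> 0"
    proof (rule Lim_null_comparison)
      show "\<forall>\<^sub>F n in sequentially. cmod (T (f n) x - g x) \<le> 1 / real (Suc n)"
        using cmod_le_l2norm[OF Tg] lim by (intro always_eventually) (meson less_imp_le order_trans)
    qed (rule LIMSEQ_inverse_real_of_nat[unfolded inverse_eq_divide])
    then show "(\<lambda>n. T (f n) x) \<longlonglongrightarrow> g x" by (rule LIM_zero_cancel)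
  qed
  then have "g = T h" by auto
  then show "g \<in> T ` l2_on A" using hA by blast
qed

text \<open>One more coordinate adds at most one dimension to the image. Either \<open>T v\<close>
  already lies in the old image, or it has positive distance \<open>e\<close> from it; then the
  coefficient of \<open>T v\<close> depends continuously on the element of the sum, and closedness
  survives.\<close>

lemma closed_image_insert:
  assumes closed: "l2_closed (T ` l2_on A)"
  shows "l2_closed (T ` l2_on (insert y A))"
proof -
  define v where "v = (\<lambda>x. if x = y then 1 else 0 :: complex)"
  have v: "v \<in> l2" by (rule l2_finite_support(1)[of "{y}"]) (auto simp: v_def)
  have Tv: "T v \<in> l2" by (rule T_l2[OF v])
  \<comment> \<open>The coefficient is \<open>f y\<close> if \<open>y\<close> is new and 0 if
    \<open>y\<close> already belongs to \<open>A\<close>, so one decomposition covers both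
    cases.\<close>
  have split: "\<exists>u\<in>l2_on A. f = (\<lambda>x. u x + c * v x)" if "f \<in> l2_on (insert y A)" "c = f y - (if y \<in> A then f y else 0)" for f c
  proof (cases "y \<in> A")
    case True
    then show ?thesis using that by (intro bexI[of _ f]) (auto simp: insert_absorb)
  next
    case False
    have "(\<lambda>x. f x - c * v x) \<in> l2"
      using that v by (intro l2_diff l2_scale) (auto simp: l2_on_def)
    then show ?thesis using that False
      by (intro bexI[of _ "\<lambda>x. f x - c * v x"]) (auto simp: v_def l2_on_def)
  qed
  have join: "(\<lambda>x. u x + c * v x) \<in> l2_on (insert y A)" if "u \<in> l2_on A" for u c
    using that v by (auto simp: l2_on_def v_def intro!: l2_add l2_scale)
  have Tjoin: "T (\<lambda>x. u x + c * v x) = (\<lambda>x. T u x + c * T v x)" for u c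
    by (simp add: tridiag_add tridiag_scale)
  show ?thesis
  proof (cases "T v \<in> T ` l2_on A")
    case True
    then obtain w where w: "w \<in> l2_on A" "T v = T w" by auto
    have "T f \<in> T ` l2_on A" if f: "f \<in> l2_on (insert y A)" for f
    proof -
      obtain u c where u: "u \<in> l2_on A" "f = (\<lambda>x. u x + c * v x)" using split[OF f] by blast
      have "T f = T (\<lambda>x. u x + c * w x)" unfolding u(2) Tjoin w(2) by (simp add: tridiag_add tridiag_scale)
      moreover have "(\<lambda>x. u x + c * w x) \<in> l2_on A"
        using u w by (auto simp: l2_on_def intro!: l2_add l2_scale)
      ultimately show ?thesis by blast
    qed
    moreover have "l2_on A \<subseteq> l2_on (insert y A)" by (auto simp: l2_on_def)
    ultimately have "T ` l2_on (insert y A) = T ` l2_on A" by blast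
    then show ?thesis using closed by simp
  next
    case False
    then obtain e where e: "e > 0" and "\<not> (\<exists>h\<in>T ` l2_on A. l2norm (\<lambda>x. h x - T v x) < e)"
      using closed Tv unfolding l2_closed_def by blast
    then have dist: "e \<le> l2norm (\<lambda>x. T u x - T v x)" if "u \<in> l2_on A" for u
      using that not_le by blast
    \<comment> \<open>By homogeneity: division by \<open>- c\<close> turns the combination into a
      difference to which \<open>dist\<close> applies.\<close>
    have coeff: "cmod c * e \<le> l2norm (\<lambda>x. T u x + c * T v x)" if "u \<in> l2_on A" for u c
    proof (cases "c = 0")
      case False
      have u': "(\<lambda>x. (- 1 / c) * u x) \<in> l2_on A"
        using that l2_scale[of u "- 1 / c"] by (auto simp: l2_on_def)
      have "l2norm (\<lambda>x. T u x + c * T v x) = l2norm (\<lambda>x. (- c) * (T (\<lambda>x. (- 1 / c) * u x) x - T v x))"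
        unfolding tridiag_scale using False by (simp add: algebra_simps)
      also have "\<dots> = cmod c * l2norm (\<lambda>x. T (\<lambda>x. (- 1 / c) * u x) x - T v x)"
        using l2norm_scale[of "- c"] by simp
      also have "\<dots> \<ge> cmod c * e" by (intro mult_left_mono dist[OF u']) auto
      finally show ?thesis .
    qed auto
    show ?thesis unfolding l2_closed_def
    proof (intro ballI impI)
      fix g assume g: "g \<in> l2"
        and approx: "\<forall>e>0. \<exists>h\<in>T ` l2_on (insert y A). l2norm (\<lambda>x. h x - g x) < e"
      obtain f where f: "\<And>n::nat. f n \<in> l2_on (insert y A)"
        and lim: "\<And>n. l2norm (\<lambda>x. T (f n) x - g x) < 1 / real (Suc n)"
        using l2_closed_obtain_seq[OF approx] by blast
      have "\<forall>n. \<exists>u c. u \<in> l2_on A \<and> f n = (\<lambda>x. u x + c * v x)" using split[OF f] by blast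
      then obtain u c where u: "\<And>n. u n \<in> l2_on A" and fu: "\<And>n. f n = (\<lambda>x. u n x + c n * v x)"
        by metis
      have fl2: "f n \<in> l2" for n using f by (auto simp: l2_on_def)
      have Tg: "(\<lambda>x. T (f n) x - g x) \<in> l2" for n by (intro l2_diff T_l2 fl2 g)
      have "cmod (c m - c n) * e \<le> 1 / real (Suc m) + 1 / real (Suc n)" for m n
      proof -
        have "cmod (c m - c n) * e \<le> l2norm (\<lambda>x. T (\<lambda>x. u m x - u n x) x + (c m - c n) * T v x)"
          by (rule coeff[OF l2_on_diff[OF u u]])
        also have "\<dots> = l2norm (\<lambda>x. (T (f m) x - g x) - (T (f n) x - g x))"
          unfolding fu Tjoin tridiag_diff by (simp add: algebra_simps)
        also have "\<dots> \<le> 1 / real (Suc m) + 1 / real (Suc n)"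
          using l2norm_diff[OF Tg[of m] Tg[of n]] lim[of m] lim[of n] by linarith
        finally show ?thesis .
      qed
      then have "Cauchy c" using e
        by (intro Cauchy_of_inverse_bound[of _ "1 / e"]) (simp_all add: field_simps del: of_nat_Suc)
      then obtain d where d: "c \<longlonglongrightarrow> d" using Cauchy_convergent convergent_def by blast
      have gd: "(\<lambda>x. g x - d * T v x) \<in> l2" by (intro l2_diff l2_scale g Tv)
      \<comment> \<open>Since the coefficients converge to \<open>d\<close>, the remaining parts
        \<open>T (u n)\<close> approach \<open>g - d * T v\<close>, and closedness of the smaller
        image yields a preimage.\<close>
      have "\<exists>h\<in>T ` l2_on A. l2norm (\<lambda>x. h x - (g x - d * T v x)) < r" if r: "r > 0" for r
      proof -
        have le: "l2norm (\<lambda>x. T (u n) x - (g x - d * T v x)) \<le> 1 / real (Suc n) + cmod (c n - d) * l2norm (T v)" for n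
        proof -
          have "l2norm (\<lambda>x. T (u n) x - (g x - d * T v x)) = l2norm (\<lambda>x. (T (f n) x - g x) - (c n - d) * T v x)"
            unfolding fu Tjoin by (simp add: algebra_simps)
          also have "\<dots> \<le> l2norm (\<lambda>x. T (f n) x - g x) + l2norm (\<lambda>x. (c n - d) * T v x)"
            by (intro l2norm_diff Tg l2_scale Tv)
          finally show ?thesis using lim[of n] by (simp add: l2norm_scale)
        qed
        have "(\<lambda>n. 1 / real (Suc n) + cmod (c n - d) * l2norm (T v)) \<longlonglongrightarrow> 0 + 0 * l2norm (T v)"
          by (intro tendsto_intros tendsto_norm_zero LIM_zero d
              LIMSEQ_inverse_real_of_nat[unfolded inverse_eq_divide])
        then have "\<forall>\<^sub>F n in sequentially. 1 / real (Suc n) + cmod (c n - d) * l2norm (T v) < r"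
          using r by (intro order_tendstoD(2)) auto
        then obtain n where "1 / real (Suc n) + cmod (c n - d) * l2norm (T v) < r"
          by (auto simp: eventually_sequentially)
        then show ?thesis using le[of n] u[of n] by (intro bexI[of _ "T (u n)"]) auto
      qed
      then have "(\<lambda>x. g x - d * T v x) \<in> T ` l2_on A"
        using closed[unfolded l2_closed_def, THEN bspec, OF gd] by blast
      then obtain w where w: "w \<in> l2_on A" "(\<lambda>x. g x - d * T v x) = T w" by auto
      have "g = T (\<lambda>x. w x + d * v x)"
        unfolding Tjoin w(2)[symmetric] by simp
      then show "g \<in> T ` l2_on (insert y A)" using join[OF w(1)] by blast
    qed
  qed
qed

lemma closed_image_cofinite:
  assumes "l2_closed (T ` l2_on A)" "finite F"
  shows "l2_closed (T ` l2_on (A \<union> F))"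
  using assms(2)
proof (induction F rule: finite_induct)
  case (insert y F)
  then show ?case using closed_image_insert[of "A \<union> F" y] by simp
qed (simp add: assms)

text \<open>The value \<open>f x\<close> enters \<open>T f\<close> only through
  \<open>\<alpha> (x - 1)\<close>, \<open>\<beta> (x + 1)\<close> and \<open>\<gamma> x\<close>, the
  entries of column \<open>x\<close> of the matrix. This handles ends where the coin is eventually
  constant and diagonal and \<open>T\<close> has a kernel.\<close>

lemma image_discard_null_columns:
  assumes "\<And>x. x \<notin> B \<Longrightarrow> \<alpha> (x - 1) = 0 \<and> \<beta> (x + 1) = 0 \<and> \<gamma> x = 0"
  shows "T ` l2 = T ` l2_on B"
proof -
  have "T f = T (\<lambda>x. if x \<in> B then f x else 0)" for f
  proof
    fix x
    show "T f x = T (\<lambda>x. if x \<in> B then f x else 0) x"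
      using assms[of "x + 1"] assms[of "x - 1"] assms[of x] by (auto simp: tridiag_def)
  qed
  moreover have "(\<lambda>x. if x \<in> B then f x else 0) \<in> l2_on B" if "f \<in> l2" for f
    using l2_dominated[OF that, of "\<lambda>x. if x \<in> B then f x else 0"] by (auto simp: l2_on_def)
  moreover have "l2_on B \<subseteq> l2" by (auto simp: l2_on_def)
  ultimately show ?thesis by blast
qed

end

section \<open>Closed range\<close>

lemma l2norm_shift_minus_scalar:
  assumes "f \<in> l2"
  shows "\<bar>1 - cmod r\<bar> * l2norm f \<le> l2norm (\<lambda>x. f (x + 1) - r * f x)"
proof -
  have a: "(\<lambda>x. f (x + 1)) \<in> l2" "(\<lambda>x. r * f x) \<in> l2"
    using assms by (simp_all add: l2_shift l2_scale)
  have "l2norm f - cmod r * l2norm f \<le> l2norm (\<lambda>x. f (x + 1) - r * f x)"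
    "cmod r * l2norm f - l2norm f \<le> l2norm (\<lambda>x. f (x + 1) - r * f x)"
    using l2norm_diff_ge[OF a] l2norm_diff_ge[OF a(2,1)] l2norm_commute[of "\<lambda>x. f (x + 1)" "\<lambda>x. r * f x"]
    by (simp_all add: l2norm_shift[of f] l2norm_scale)
  then show ?thesis by (auto simp: abs_if algebra_simps)
qed

text \<open>The operator factors as \<open>\<alpha> L\<^sup>* (L - r) (L - s)\<close>, where \<open>r\<close>, \<open>s\<close> are
  the roots of \<open>\<alpha> z\<^sup>2 + \<gamma> z + \<beta>\<close>, and \<open>\<parallel>(L - r) f\<parallel> \<ge> \<bar>1 - \<bar>r\<bar>\<bar> \<parallel>f\<parallel>\<close>.\<close>

lemma constant_tridiag_bounded_below:
  assumes deg: "\<alpha> = 0 \<Longrightarrow> \<beta> = 0"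
    and symbol: "\<And>z. cmod z = 1 \<Longrightarrow> \<alpha> * z + \<beta> / z + \<gamma> \<noteq> 0"
  shows "\<exists>c>0. \<forall>f\<in>l2. c * l2norm f \<le> l2norm (tridiag (\<lambda>_. \<alpha>) (\<lambda>_. \<beta>) (\<lambda>_. \<gamma>) f)"
proof (cases "\<alpha> = 0")
  case True
  then have "\<gamma> \<noteq> 0" using symbol[of 1] deg by auto
  moreover have "tridiag (\<lambda>_. \<alpha>) (\<lambda>_. \<beta>) (\<lambda>_. \<gamma>) f = (\<lambda>x. \<gamma> * f x)" for f
    using True deg by (auto simp: tridiag_def)
  ultimately show ?thesis by (intro exI[of _ "cmod \<gamma>"]) (auto simp: l2norm_scale)
next
  case False
  define w where "w = csqrt (\<gamma>\<^sup>2 - 4 * \<alpha> * \<beta>)"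
  define r where "r = (- \<gamma> + w) / (2 * \<alpha>)"
  define s where "s = (- \<gamma> - w) / (2 * \<alpha>)"
  have w2: "w\<^sup>2 = \<gamma>\<^sup>2 - 4 * \<alpha> * \<beta>" by (simp add: w_def)
  have "\<alpha> * (r * s) * (4 * \<alpha>) = (- \<gamma> + w) * (- \<gamma> - w)"
    using False by (simp add: r_def s_def)
  also have "\<dots> = \<beta> * (4 * \<alpha>)" using w2 by (simp add: algebra_simps power2_eq_square)
  finally have \<beta>: "\<beta> = \<alpha> * (r * s)" using False by simp
  have "r + s = - \<gamma> / \<alpha>" using False by (simp add: r_def s_def field_simps)
  then have \<gamma>: "\<gamma> = - \<alpha> * (r + s)" using False by (simp add: field_simps)
  have "cmod r \<noteq> 1"
  proof
    assume r1: "cmod r = 1"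
    then have "r \<noteq> 0" by auto
    then have "\<alpha> * r + \<beta> / r + \<gamma> = 0" unfolding \<beta> \<gamma> by (simp add: field_simps)
    then show False using symbol r1 by blast
  qed
  moreover have "cmod s \<noteq> 1"
  proof
    assume s1: "cmod s = 1"
    then have "s \<noteq> 0" by auto
    then have "\<alpha> * s + \<beta> / s + \<gamma> = 0" unfolding \<beta> \<gamma> by (simp add: field_simps)
    then show False using symbol s1 by blast
  qed
  ultimately have pos: "0 < cmod \<alpha> * (\<bar>1 - cmod s\<bar> * \<bar>1 - cmod r\<bar>)" using False by auto
  have "cmod \<alpha> * (\<bar>1 - cmod s\<bar> * \<bar>1 - cmod r\<bar>) * l2norm f
      \<le> l2norm (tridiag (\<lambda>_. \<alpha>) (\<lambda>_. \<beta>) (\<lambda>_. \<gamma>) f)" if f: "f \<in> l2" for f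
  proof -
    \<comment> \<open>\<open>g\<close> is the inner factor \<open>L - r\<close> applied to
      \<open>f\<close> and shifted back by one, so that \<open>\<alpha> (L - s)\<close> applied to
      \<open>g\<close> is the whole operator.\<close>
    define g where "g x = f x - r * f (x - 1)" for x
    have g: "g \<in> l2" unfolding g_def[abs_def] using f by (intro l2_diff l2_scale) (simp_all add: l2_shift_minus)
    have "\<bar>1 - cmod r\<bar> * l2norm f \<le> l2norm (\<lambda>x. g (x + 1))"
      using l2norm_shift_minus_scalar[OF f, of r] by (simp add: g_def)
    then have "\<bar>1 - cmod s\<bar> * (\<bar>1 - cmod r\<bar> * l2norm f) \<le> \<bar>1 - cmod s\<bar> * l2norm g"
      by (intro mult_left_mono) (simp_all add: l2norm_shift)
    also have "\<dots> \<le> l2norm (\<lambda>x. g (x + 1) - s * g x)" by (rule l2norm_shift_minus_scalar[OF g])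
    finally have "cmod \<alpha> * (\<bar>1 - cmod s\<bar> * (\<bar>1 - cmod r\<bar> * l2norm f))
        \<le> l2norm (\<lambda>x. \<alpha> * (g (x + 1) - s * g x))"
      unfolding l2norm_scale by (intro mult_left_mono) auto
    moreover have "tridiag (\<lambda>_. \<alpha>) (\<lambda>_. \<beta>) (\<lambda>_. \<gamma>) f = (\<lambda>x. \<alpha> * (g (x + 1) - s * g x))"
      unfolding tridiag_def[abs_def] g_def \<beta> \<gamma> by (auto simp: algebra_simps)
    ultimately show ?thesis by (simp add: mult.assoc)
  qed
  then show ?thesis using pos by blast
qed

text \<open>Near \<open>+\<infinity>\<close> the operator is bounded below (\<open>A = {N<..}\<close>) or its columns
  vanish (\<open>A = {}\<close>).\<close>

definition regular_at_top where
  "regular_at_top \<alpha> \<beta> \<gamma> \<longleftrightarrow> (\<exists>N A C. 0 \<le> C \<and> A \<subseteq> {N<..} \<and>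
     (\<forall>f\<in>l2_on A. l2norm f \<le> C * l2norm (tridiag \<alpha> \<beta> \<gamma> f)) \<and>
     (\<forall>x>N. x \<notin> A \<longrightarrow> \<alpha> (x - 1) = 0 \<and> \<beta> (x + 1) = 0 \<and> \<gamma> x = 0))"

lemma regular_at_top_zero_columns:
  assumes "\<forall>\<^sub>F x in at_top. \<alpha> (x - 1) = 0 \<and> \<beta> (x + 1) = 0 \<and> \<gamma> x = 0"
  shows "regular_at_top \<alpha> \<beta> \<gamma>"
proof -
  obtain N where "\<And>x. x \<ge> N \<Longrightarrow> \<alpha> (x - 1) = 0 \<and> \<beta> (x + 1) = 0 \<and> \<gamma> x = 0"
    using assms unfolding eventually_at_top_linorder by blast
  moreover have "l2norm f = 0" if "f \<in> l2_on {}" for f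
  proof -
    have "f = (\<lambda>x. 0)" using that by (auto simp: l2_on_def)
    then show ?thesis by simp
  qed
  ultimately show ?thesis unfolding regular_at_top_def
    by (intro exI[of _ N] exI[of _ "{}"] exI[of _ 0]) auto
qed

text \<open>Reflection exchanges the two off-diagonals. It reduces the behaviour at the left end to
  that at the right end.\<close>

lemma tridiag_reflect:
  "tridiag \<alpha> \<beta> \<gamma> f (- x) = tridiag (\<lambda>x. \<beta> (- x)) (\<lambda>x. \<alpha> (- x)) (\<lambda>x. \<gamma> (- x)) (\<lambda>x. f (- x)) x"
  by (simp add: tridiag_def minus_diff_commute)

lemma l2_uminus: "(\<lambda>x. f (- x)) \<in> l2 \<longleftrightarrow> f \<in> l2"
  and l2norm_uminus: "l2norm (\<lambda>x. f (- x)) = l2norm f"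
  using l2_reindex[OF bij_int_uminus] l2norm_reindex[OF bij_int_uminus] by auto

context bounded_tridiag
begin

text \<open>Far out, \<open>T\<close> is a small perturbation of its limit operator, which is
  bounded below by \<open>constant_tridiag_bounded_below\<close>.\<close>

lemma regular_at_top_symbol:
  assumes lim: "(\<alpha> \<longlongrightarrow> \<alpha>0) at_top" "(\<beta> \<longlongrightarrow> \<beta>0) at_top" "(\<gamma> \<longlongrightarrow> \<gamma>0) at_top"
    and deg: "\<alpha>0 = 0 \<Longrightarrow> \<beta>0 = 0"
    and symbol: "\<And>z. cmod z = 1 \<Longrightarrow> \<alpha>0 * z + \<beta>0 / z + \<gamma>0 \<noteq> 0"
  shows "regular_at_top \<alpha> \<beta> \<gamma>"
proof -
  let ?T0 = "tridiag (\<lambda>_. \<alpha>0) (\<lambda>_. \<beta>0) (\<lambda>_. \<gamma>0)"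
  let ?D = "tridiag (\<lambda>x. \<alpha> x - \<alpha>0) (\<lambda>x. \<beta> x - \<beta>0) (\<lambda>x. \<gamma> x - \<gamma>0)"
  obtain c where c: "c > 0" and below: "\<And>f. f \<in> l2 \<Longrightarrow> c * l2norm f \<le> l2norm (?T0 f)"
    using constant_tridiag_bounded_below[OF deg symbol] by blast
  \<comment> \<open>Three coefficients of size \<open>c / 6\<close> give a perturbation of norm at
    most \<open>c / 2\<close>; half of the lower bound \<open>c\<close> remains, whence the constant
    \<open>2 / c\<close>.\<close>
  have "\<forall>\<^sub>F x in at_top. cmod (\<alpha> x - \<alpha>0) < c / 6 \<and> cmod (\<beta> x - \<beta>0) < c / 6 \<and> cmod (\<gamma> x - \<gamma>0) < c / 6"
    using lim[THEN tendstoD, of "c / 6"] c by (auto simp: dist_norm eventually_conj_iff)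
  then obtain N where N: "\<And>x. x \<ge> N \<Longrightarrow> cmod (\<alpha> x - \<alpha>0) < c / 6 \<and> cmod (\<beta> x - \<beta>0) < c / 6 \<and> cmod (\<gamma> x - \<gamma>0) < c / 6"
    unfolding eventually_at_top_linorder by blast
  \<comment> \<open>A site \<open>y\<close> of the support affects rows from \<open>y - 1\<close>
    on, so the support starts one step beyond \<open>N\<close>.\<close>
  have "l2norm f \<le> 2 / c * l2norm (T f)" if "f \<in> l2_on {N + 1<..}" for f
  proof -
    have f: "f \<in> l2" and supp: "\<And>x. f x \<noteq> 0 \<Longrightarrow> x > N + 1"
      using that by (auto simp: l2_on_def simp del: not_less)
    have nn: "cmod (\<alpha> x - \<alpha>0) \<le> c / 6 \<and> cmod (\<beta> x - \<beta>0) \<le> c / 6 \<and> cmod (\<gamma> x - \<gamma>0) \<le> c / 6"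
      if "f y \<noteq> 0" "y \<le> x + 1" for x y
      using N[of x] supp[of y] that by force
    have nn': "f (x + 1) \<noteq> 0 \<Longrightarrow> cmod (\<alpha> x - \<alpha>0) \<le> c / 6"
      "f (x - 1) \<noteq> 0 \<Longrightarrow> cmod (\<beta> x - \<beta>0) \<le> c / 6"
      "f x \<noteq> 0 \<Longrightarrow> cmod (\<gamma> x - \<gamma>0) \<le> c / 6" for x
      using nn[of "x + 1" x] nn[of "x - 1" x] nn[of x x] by simp_all
    have D: "?D f \<in> l2" "l2norm (?D f) \<le> 3 * (c / 6) * l2norm f"
      using c by (intro l2_tridiag[OF f _ nn'] l2norm_tridiag_le[OF f _ nn']; simp)+
    have "?T0 f = (\<lambda>x. T f x - ?D f x)" by (auto simp: tridiag_def algebra_simps)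
    then have "l2norm (?T0 f) \<le> l2norm (T f) + l2norm (?D f)"
      using l2norm_diff[OF T_l2[OF f] D(1)] by simp
    then have "c * l2norm f \<le> 2 * l2norm (T f)"
      using below[OF f] D(2) by (simp add: field_simps)
    then show ?thesis using c by (simp add: field_simps)
  qed
  then show ?thesis unfolding regular_at_top_def using c
    by (intro exI[of _ "N + 1"] exI[of _ "{N + 1<..}"] exI[of _ "2 / c"]) auto
qed

text \<open>The lower bounds at the two ends combine on sequences vanishing on a central window.
  Restoring the window adds finitely many coordinates, and every other omitted coordinate has a null
  column.\<close>

theorem closed_range_if_regular:
  assumes "regular_at_top \<alpha> \<beta> \<gamma>" "regular_at_top (\<lambda>x. \<beta> (- x)) (\<lambda>x. \<alpha> (- x)) (\<lambda>x. \<gamma> (- x))"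
  shows "l2_closed (T ` l2)"
proof -
  let ?T' = "tridiag (\<lambda>x. \<beta> (- x)) (\<lambda>x. \<alpha> (- x)) (\<lambda>x. \<gamma> (- x))"
  obtain N A C where R: "0 \<le> C" "A \<subseteq> {N<..}" "\<And>f. f \<in> l2_on A \<Longrightarrow> l2norm f \<le> C * l2norm (T f)"
    "\<And>x. x > N \<Longrightarrow> x \<notin> A \<Longrightarrow> \<alpha> (x - 1) = 0 \<and> \<beta> (x + 1) = 0 \<and> \<gamma> x = 0"
    using assms(1) unfolding regular_at_top_def by blast
  obtain N' A' C' where L: "0 \<le> C'" "A' \<subseteq> {N'<..}" "\<And>f. f \<in> l2_on A' \<Longrightarrow> l2norm f \<le> C' * l2norm (?T' f)"
    "\<And>x. x > N' \<Longrightarrow> x \<notin> A' \<Longrightarrow> \<beta> (- (x - 1)) = 0 \<and> \<alpha> (- (x + 1)) = 0 \<and> \<gamma> (- x) = 0"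
    using assms(2) unfolding regular_at_top_def by blast
  \<comment> \<open>With \<open>M \<ge> 1\<close>, a sequence supported in \<open>D\<close> vanishes
    at -1, 0 and 1. Hence \<open>T\<close> maps its two halves to the restrictions of
    \<open>T f\<close> to the two half-lines.\<close>
  define M where "M = max 1 (max N N')"
  have M: "1 \<le> M" "N \<le> M" "N' \<le> M" by (auto simp: M_def)
  define D where "D = {x. x \<in> A \<and> M < x \<or> - x \<in> A' \<and> M < - x}"
  have "l2norm f \<le> (C + C') * l2norm (T f)" if "f \<in> l2_on D" for f
  proof -
    have f: "f \<in> l2" and f0: "\<And>x. x \<notin> D \<Longrightarrow> f x = 0" using that by (auto simp: l2_on_def)
    define f1 where "f1 x = (if x > 0 then f x else 0)" for x
    define f2 where "f2 x = (if x < 0 then f x else 0)" for x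
    have l: "f1 \<in> l2" "f2 \<in> l2"
      using l2_dominated[OF f, of f1] l2_dominated[OF f, of f2] by (auto simp: f1_def f2_def)
    have z: "f 1 = 0" "f 0 = 0" "f (- 1) = 0" using M by (auto intro!: f0 simp: D_def)
    have "T f1 x = (if x > 0 then T f x else 0)" for x
      using z by (cases "x = 1"; cases "x = 0") (auto simp: tridiag_def f1_def)
    then have T1: "l2norm (T f1) \<le> l2norm (T f)"
      by (intro l2norm_dominated[OF T_l2[OF f]]) auto
    have "T f2 x = (if x < 0 then T f x else 0)" for x
      using z by (cases "x = -1"; cases "x = 0") (auto simp: tridiag_def f2_def)
    then have T2: "l2norm (T f2) \<le> l2norm (T f)"
      by (intro l2norm_dominated[OF T_l2[OF f]]) auto
    have "f1 \<in> l2_on A" using l f0 M by (auto simp: l2_on_def f1_def D_def)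
    then have n1: "l2norm f1 \<le> C * l2norm (T f)"
      using R(3) mult_left_mono[OF T1 R(1)] by force
    have "(\<lambda>x. f2 (- x)) \<in> l2" using l by (simp add: l2_uminus)
    moreover have "f2 (- x) = 0" if "x \<notin> A'" for x using f0 M that by (auto simp: f2_def D_def)
    ultimately have "(\<lambda>x. f2 (- x)) \<in> l2_on A'" by (simp add: l2_on_def)
    then have "l2norm (\<lambda>x. f2 (- x)) \<le> C' * l2norm (?T' (\<lambda>x. f2 (- x)))" by (rule L(3))
    also have "?T' (\<lambda>x. f2 (- x)) = (\<lambda>x. T f2 (- x))" by (auto simp: tridiag_reflect)
    finally have n2: "l2norm f2 \<le> C' * l2norm (T f)"
      using mult_left_mono[OF T2 L(1)] by (simp only: l2norm_uminus)
    have "f = (\<lambda>x. f1 x + f2 x)" using z by (auto simp: f1_def f2_def fun_eq_iff not_less order.order_iff_strict)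
    then have "l2norm f \<le> l2norm f1 + l2norm f2" using l2norm_add[OF l] by simp
    then show ?thesis using n1 n2 by (simp add: algebra_simps)
  qed
  then have "l2_closed (T ` l2_on D)"
    using R(1) L(1) by (intro closed_image_bounded_below[of _ "C + C'"]) auto
  then have "l2_closed (T ` l2_on (D \<union> {- M..M}))" by (rule closed_image_cofinite) simp
  moreover have "T ` l2 = T ` l2_on (D \<union> {- M..M})"
  proof (rule image_discard_null_columns)
    fix x assume x: "x \<notin> D \<union> {- M..M}"
    show "\<alpha> (x - 1) = 0 \<and> \<beta> (x + 1) = 0 \<and> \<gamma> x = 0"
    proof (cases "x > M")
      case True
      then show ?thesis using x M by (intro R(4)) (auto simp: D_def)
    next
      case False
      then show ?thesis using x M L(4)[of "- x"] by (auto simp: D_def algebra_simps)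
    qed
  qed
  ultimately show ?thesis by simp
qed

end

section \<open>Failure of closed range\<close>

context bounded_tridiag
begin

text \<open>A truncated plane wave: \<open>T\<close> acts on it as its limit at \<open>+\<infinity>\<close> up to a
  small error, and the limit operator only sees the four points at the ends.\<close>

lemma approximate_null_vector:
  assumes lim: "(\<alpha> \<longlongrightarrow> \<alpha>0) at_top" "(\<beta> \<longlongrightarrow> \<beta>0) at_top" "(\<gamma> \<longlongrightarrow> \<gamma>0) at_top"
    and z: "cmod z = 1" and symbol: "\<alpha>0 * z + \<beta>0 / z + \<gamma>0 = 0" and e: "e > 0"
  shows "\<exists>f M. N < M \<and> (\<forall>x. f x \<noteq> 0 \<longrightarrow> N < x \<and> x < M - 1) \<and> l2norm f = 1 \<and> l2norm (T f) \<le> e"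
proof -
  let ?T0 = "tridiag (\<lambda>_. \<alpha>0) (\<lambda>_. \<beta>0) (\<lambda>_. \<gamma>0)"
  let ?D = "tridiag (\<lambda>x. \<alpha> x - \<alpha>0) (\<lambda>x. \<beta> x - \<beta>0) (\<lambda>x. \<gamma> x - \<gamma>0)"
  have z0: "z \<noteq> 0" using z by auto
  have "\<forall>\<^sub>F x in at_top. cmod (\<alpha> x - \<alpha>0) < e / 6 \<and> cmod (\<beta> x - \<beta>0) < e / 6 \<and> cmod (\<gamma> x - \<gamma>0) < e / 6"
    using lim[THEN tendstoD, of "e / 6"] e by (auto simp: dist_norm eventually_conj_iff)
  then obtain N1 where N1: "\<And>x. x \<ge> N1 \<Longrightarrow> cmod (\<alpha> x - \<alpha>0) < e / 6 \<and> cmod (\<beta> x - \<beta>0) < e / 6 \<and> cmod (\<gamma> x - \<gamma>0) < e / 6"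
    unfolding eventually_at_top_linorder by blast
  define k where "k = cmod \<alpha>0 + cmod \<beta>0 + cmod \<gamma>0"
  \<comment> \<open>At most four end points contribute at most \<open>k^2 / n\<close> each to the
    squared norm; this length makes their sum at most \<open>(e / 2)^2\<close>.\<close>
  obtain n0 :: nat where n0: "16 * k\<^sup>2 / e\<^sup>2 \<le> real n0" using real_arch_simple by blast
  define n where "n = n0 + 1"
  have n: "n > 0" and nk: "4 * k\<^sup>2 / real n \<le> (e / 2)\<^sup>2"
  proof -
    have "16 * k\<^sup>2 / e\<^sup>2 \<le> real n" using n0 by (simp add: n_def)
    then show "4 * k\<^sup>2 / real n \<le> (e / 2)\<^sup>2"
      using e by (simp add: n_def power_divide divide_simps mult.commute)
  qed (simp add: n_def)
  \<comment> \<open>The shift by one beyond \<open>N1\<close> covers row \<open>m - 1\<close>, the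
    first one affected by the support.\<close>
  define m where "m = max (N + 1) (N1 + 1)"
  define M where "M = m + int n + 1"
  define f where "f x = (if m \<le> x \<and> x < m + int n then z powi x / sqrt n else 0)" for x
  have norm_f: "cmod (f x) = (if m \<le> x \<and> x < m + int n then 1 / sqrt n else 0)" for x
    using z by (simp add: f_def norm_divide norm_power_int)
  have fsupp: "f x = 0" if "x \<notin> {m..<m + int n}" for x using that by (auto simp: f_def)
  have f: "f \<in> l2" by (rule l2_finite_support(1)[of "{m..<m + int n}"]) (simp, rule fsupp)
  have "(l2norm f)\<^sup>2 = (\<Sum>x\<in>{m..<m + int n}. (cmod (f x))\<^sup>2)"
    by (rule l2_finite_support(2)) (simp, rule fsupp)
  also have "\<dots> = (\<Sum>x\<in>{m..<m + int n}. 1 / real n)"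
    by (rule sum.cong) (simp_all add: norm_f power_divide)
  also have "\<dots> = 1" using n by simp
  finally have f1: "l2norm f = 1" using l2norm_nonneg[of f] by (auto simp: power2_eq_1_iff)
  have nn: "cmod (\<alpha> x - \<alpha>0) \<le> e / 6 \<and> cmod (\<beta> x - \<beta>0) \<le> e / 6 \<and> cmod (\<gamma> x - \<gamma>0) \<le> e / 6"
    if "f y \<noteq> 0" "y \<le> x + 1" for x y
    using N1[of x] fsupp[of y] that by (force simp: m_def)
  have nn': "f (x + 1) \<noteq> 0 \<Longrightarrow> cmod (\<alpha> x - \<alpha>0) \<le> e / 6"
    "f (x - 1) \<noteq> 0 \<Longrightarrow> cmod (\<beta> x - \<beta>0) \<le> e / 6"
    "f x \<noteq> 0 \<Longrightarrow> cmod (\<gamma> x - \<gamma>0) \<le> e / 6" for x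
    using nn[of "x + 1" x] nn[of "x - 1" x] nn[of x x] by simp_all
  have D: "?D f \<in> l2" "l2norm (?D f) \<le> 3 * (e / 6) * l2norm f"
    using e by (intro l2_tridiag[OF f _ nn'] l2norm_tridiag_le[OF f _ nn']; simp)+
  let ?E = "{m - 1, m, m + int n - 1, m + int n}"
  have T0: "?T0 f x = 0" if "x \<notin> ?E" for x
  proof (cases "m < x \<and> x < m + int n - 1")
    case True
    then have "?T0 f x = z powi x / sqrt n * (\<alpha>0 * z + \<beta>0 / z + \<gamma>0)"
      using z0 by (simp add: tridiag_def f_def power_int_add power_int_diff add_divide_distrib algebra_simps)
    then show ?thesis using symbol by simp
  next
    case False
    then show ?thesis using that by (auto simp: tridiag_def f_def)
  qed
  have le: "cmod (?T0 f x) \<le> k / sqrt n" for x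
  proof -
    have s: "cmod (f y) \<le> 1 / sqrt n" for y by (simp add: norm_f)
    have "cmod (?T0 f x) \<le> cmod \<alpha>0 * cmod (f (x + 1)) + cmod \<beta>0 * cmod (f (x - 1)) + cmod \<gamma>0 * cmod (f x)"
      using norm_triangle_ineq[of "\<alpha>0 * f (x + 1) + \<beta>0 * f (x - 1)" "\<gamma>0 * f x"]
        norm_triangle_ineq[of "\<alpha>0 * f (x + 1)" "\<beta>0 * f (x - 1)"]
      by (simp add: tridiag_def norm_mult)
    also have "\<dots> \<le> cmod \<alpha>0 * (1 / sqrt n) + cmod \<beta>0 * (1 / sqrt n) + cmod \<gamma>0 * (1 / sqrt n)"
      by (intro add_mono mult_left_mono s) auto
    finally show ?thesis by (simp add: k_def add_divide_distrib)
  qed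
  have "(l2norm (?T0 f))\<^sup>2 = (\<Sum>x\<in>?E. (cmod (?T0 f x))\<^sup>2)"
    by (rule l2_finite_support(2)) (simp, rule T0)
  also have "\<dots> \<le> (\<Sum>x\<in>?E. (k / sqrt n)\<^sup>2)"
    by (intro sum_mono power_mono le) auto
  also have "\<dots> = card ?E * (k\<^sup>2 / n)" by (simp only: sum_constant power_divide) simp
  also have "\<dots> \<le> 4 * (k\<^sup>2 / n)"
    by (intro mult_right_mono) (simp_all add: card_insert_if)
  also have "\<dots> \<le> (e / 2)\<^sup>2" using nk by simp
  finally have T0n: "l2norm (?T0 f) \<le> e / 2" using e by (simp add: power2_le_iff_abs_le)
  have "T f = (\<lambda>x. ?T0 f x + ?D f x)" by (auto simp: tridiag_def algebra_simps)
  moreover have "?T0 f \<in> l2" by (rule l2_finite_support(1)[of ?E]) (simp, rule T0)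
  ultimately have "l2norm (T f) \<le> e"
    using l2norm_add[of "?T0 f" "?D f"] D T0n f1 by simp
  moreover have "N < M" "\<forall>x. f x \<noteq> 0 \<longrightarrow> N < x \<and> x < M - 1" by (auto simp: M_def m_def f_def)
  ultimately show ?thesis using f1 by blast
qed

end

section \<open>Disjoint humps and their glued combinations\<close>

text \<open>\<open>\<kappa>\<close> assigns each site to a block. As the block of a hump contains
  the neighbours of its support as well, the images \<open>T (f k)\<close> also have disjoint
  supports. The condition \<open>supp_ge\<close> drives the humps to the right end.\<close>

locale hump_sequence = bounded_tridiag +
  fixes f :: "nat \<Rightarrow> int \<Rightarrow> complex" and \<kappa> :: "int \<Rightarrow> nat"
  assumes norm_f: "\<And>k. l2norm (f k) = 1"
    and norm_Tf: "\<And>k. l2norm (T (f k)) \<le> (1 / 2) ^ k"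
    and finite_supp: "\<And>k. finite {x. f k x \<noteq> 0}"
    and supp_index: "\<And>k x. f k x \<noteq> 0 \<Longrightarrow> \<kappa> (x - 1) = k \<and> \<kappa> x = k \<and> \<kappa> (x + 1) = k"
    and supp_ge: "\<And>k x. f k x \<noteq> 0 \<Longrightarrow> int k \<le> x"

lemma (in bounded_tridiag) hump_sequence_exists:
  assumes lim: "(\<alpha> \<longlongrightarrow> \<alpha>0) at_top" "(\<beta> \<longlongrightarrow> \<beta>0) at_top" "(\<gamma> \<longlongrightarrow> \<gamma>0) at_top"
    and z: "cmod z = 1" and symbol: "\<alpha>0 * z + \<beta>0 / z + \<gamma>0 = 0"
  shows "\<exists>f \<kappa>. hump_sequence \<alpha> \<beta> \<gamma> K f \<kappa>"
proof -
  have "\<forall>N (k::nat). \<exists>f M. N < M \<and> (\<forall>x. f x \<noteq> 0 \<longrightarrow> N < x \<and> x < M - 1) \<and> l2norm f = 1 \<and>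
      l2norm (T f) \<le> (1 / 2) ^ k"
    using approximate_null_vector[OF lim z symbol] by simp
  then obtain F M where FM: "\<And>N k. N < M N k" "\<And>N k x. F N k x \<noteq> 0 \<Longrightarrow> N < x \<and> x < M N k - 1"
    "\<And>N k. l2norm (F N k) = 1" "\<And>N (k::nat). l2norm (T (F N k)) \<le> (1 / 2) ^ k"
    by metis
  \<comment> \<open>The blocks are built recursively: \<open>m k\<close> is the left border of block
    \<open>k\<close>, and \<open>M\<close> returns the border behind the hump chosen there.\<close>
  define m where "m = rec_nat 0 (\<lambda>k N. M N k)"
  define f where "f k = F (m k) k" for k
  \<comment> \<open>This is the block with \<open>m k \<le> x < m (Suc k)\<close>; all sites left of
    \<open>m 0\<close> go to block 0.\<close>
  define \<kappa> where "\<kappa> x = (LEAST k. x < m (Suc k))" for x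
  have mSuc: "m (Suc k) = M (m k) k" for k by (simp add: m_def)
  have lt: "m k < m (Suc k)" for k by (simp add: mSuc FM)
  have mono: "m j \<le> m k" if "j \<le> k" for j k
    by (rule lift_Suc_mono_le[of m, OF less_imp_le[OF lt] that])
  have ge: "int k \<le> m k" for k
  proof (induction k)
    case (Suc k)
    then show ?case using lt[of k] by simp
  qed (simp add: m_def)
  have kap: "\<kappa> x = k" if "m k \<le> x" "x < m (Suc k)" for x k
    unfolding \<kappa>_def
  proof (rule Least_equality)
    fix j assume j: "x < m (Suc j)"
    show "k \<le> j"
    proof (rule ccontr)
      assume "\<not> k \<le> j"
      then have "m (Suc j) \<le> m k" by (intro mono) simp
      then show False using j that by simp
    qed
  qed (rule that)
  have supp: "m k < x \<and> x < m (Suc k) - 1" if "f k x \<noteq> 0" for k x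
    using FM(2)[of "m k" k x] that by (simp add: f_def mSuc)
  have "hump_sequence \<alpha> \<beta> \<gamma> K f \<kappa>"
  proof
    fix k x
    show "l2norm (f k) = 1" "l2norm (T (f k)) \<le> (1 / 2) ^ k" by (simp_all add: f_def FM)
    show "finite {x. f k x \<noteq> 0}"
      by (rule finite_subset[of _ "{m k..m (Suc k)}"]) (use supp in force)+
    assume *: "f k x \<noteq> 0"
    show "\<kappa> (x - 1) = k \<and> \<kappa> x = k \<and> \<kappa> (x + 1) = k"
      using supp[OF *] by (intro conjI kap) auto
    show "int k \<le> x" using supp[OF *] ge[of k] by simp
  qed
  then show ?thesis by blast
qed

context hump_sequence
begin

text \<open>The formal series of the \<open>c k * f k\<close>: at a site \<open>x\<close> only the
  term with index \<open>\<kappa> x\<close> can be nonzero, so the series makes sense even when its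
  sum is outside \<open>l2\<close>.\<close>

definition glue :: "(nat \<Rightarrow> complex) \<Rightarrow> int \<Rightarrow> complex" where
  "glue c x = c (\<kappa> x) * f (\<kappa> x) x"

lemma f_l2: "f k \<in> l2"
  by (rule l2_finite_support(1)[OF finite_supp[of k]]) auto

text \<open>If the neighbour \<open>y\<close> lies in another block than \<open>x\<close>, then
  neither the hump of its own block nor that of \<open>x\<close> is nonzero at
  \<open>y\<close>.\<close>

lemma glue_neighbour:
  assumes "y = x \<or> y = x + 1 \<or> y = x - 1"
  shows "glue c y = c (\<kappa> x) * f (\<kappa> x) y"
  using supp_index[of "\<kappa> x" y] supp_index[of "\<kappa> y" y] assms unfolding glue_def by fastforce

lemma T_glue: "T (glue c) x = c (\<kappa> x) * T (f (\<kappa> x)) x"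
  using glue_neighbour[of "x + 1" x c] glue_neighbour[of "x - 1" x c] glue_neighbour[of x x c]
  by (simp add: tridiag_def algebra_simps)

lemma glue_finite:
  assumes "\<And>k. k \<ge> n \<Longrightarrow> c k = 0"
  shows "glue c \<in> l2"
proof (rule l2_finite_support(1))
  show "finite (\<Union>k<n. {x. f k x \<noteq> 0})" using finite_supp by simp
  show "glue c x = 0" if "x \<notin> (\<Union>k<n. {x. f k x \<noteq> 0})" for x
    using that assms[of "\<kappa> x"] by (force simp: glue_def not_less)
qed

text \<open>Block \<open>k\<close> contributes at most \<open>(1 / 4) ^ k\<close> to the squared
  norm, and the blocks before \<open>n\<close> contribute nothing; a geometric tail remains.\<close>

lemma
  assumes c: "\<And>k. cmod (c k) \<le> 1" "\<And>k. k < n \<Longrightarrow> c k = 0"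
  shows T_glue_l2: "T (glue c) \<in> l2" and l2norm_T_glue: "l2norm (T (glue c)) \<le> 2 * (1 / 2) ^ n"
proof -
  have bound: "(\<Sum>x\<in>F. (cmod (T (glue c) x))\<^sup>2) \<le> (2 * (1 / 2) ^ n)\<^sup>2" if F: "finite F" for F
  proof -
    have "(\<Sum>x\<in>F. (cmod (T (glue c) x))\<^sup>2) =
        (\<Sum>k\<in>\<kappa> ` F. \<Sum>x\<in>{x \<in> F. \<kappa> x = k}. (cmod (T (glue c) x))\<^sup>2)"
      by (rule sum.image_gen[OF F])
    also have "\<dots> \<le> (\<Sum>k\<in>\<kappa> ` F. if n \<le> k then (1 / 4) ^ k else 0)"
    proof (rule sum_mono)
      fix k
      have "(\<Sum>x\<in>{x \<in> F. \<kappa> x = k}. (cmod (T (glue c) x))\<^sup>2)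
          = (cmod (c k))\<^sup>2 * (L2_set (\<lambda>x. cmod (T (f k) x)) {x \<in> F. \<kappa> x = k})\<^sup>2"
        by (simp add: T_glue norm_mult power_mult_distrib L2_set_def sum_nonneg sum_distrib_left)
      also have "\<dots> \<le> (if n \<le> k then 1 else 0) * ((1 / 2) ^ k)\<^sup>2"
      proof (intro mult_mono power_mono)
        show "(cmod (c k))\<^sup>2 \<le> (if n \<le> k then 1 else 0)"
          using c(1)[of k] c(2)[of k] by (auto simp: power_le_one)
        show "L2_set (\<lambda>x. cmod (T (f k) x)) {x \<in> F. \<kappa> x = k} \<le> (1 / 2) ^ k"
          using L2_set_le_l2norm[OF T_l2[OF f_l2[of k]], of "{x \<in> F. \<kappa> x = k}"] norm_Tf[of k] F by simp
      qed auto
      also have "((1 / 2 :: real) ^ k)\<^sup>2 = (1 / 4) ^ k"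
        by (simp add: power2_eq_square power_mult_distrib[symmetric])
      finally show "(\<Sum>x\<in>{x \<in> F. \<kappa> x = k}. (cmod (T (glue c) x))\<^sup>2) \<le> (if n \<le> k then (1 / 4) ^ k else 0)"
        by (simp split: if_splits)
    qed
    also have "\<dots> = (\<Sum>k\<in>{k \<in> \<kappa> ` F. n \<le> k}. (1 / 4) ^ k)"
      using F by (simp add: sum.inter_filter)
    also have "\<dots> \<le> (\<Sum>k\<in>{n..<n + Suc (Max (\<kappa> ` F))}. (1 / 4) ^ k)"
    proof (rule sum_mono2)
      show "{k \<in> \<kappa> ` F. n \<le> k} \<subseteq> {n..<n + Suc (Max (\<kappa> ` F))}"
        using F Max_ge[of "\<kappa> ` F"] by (force simp: less_Suc_eq_le intro: trans_le_add2)
    qed auto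
    \<comment> \<open>The tail is below \<open>4 / 3 * (1 / 4) ^ n\<close>; the factor is enlarged
      to 4 to obtain a perfect square.\<close>
    also have "\<dots> \<le> 4 * (1 / 4) ^ n"
    proof -
      have geometric: "(\<Sum>k\<in>{n..<n + j}. (1 / 4 :: real) ^ k) = 4 / 3 * ((1 / 4) ^ n - (1 / 4) ^ (n + j))" for j
        by (induction j) (simp_all add: algebra_simps)
      have "0 \<le> (1 / 4 :: real) ^ n" "0 \<le> (1 / 4 :: real) ^ (n + Suc (Max (\<kappa> ` F)))" by simp_all
      then show ?thesis unfolding geometric by argo
    qed
    also have "\<dots> = (2 * (1 / 2) ^ n)\<^sup>2"
      by (simp add: power2_eq_square power_mult_distrib[symmetric])
    finally show ?thesis .
  qed
  have "L2_set (\<lambda>x. cmod (T (glue c) x)) F \<le> 2 * (1 / 2) ^ n" if "finite F" for F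
    unfolding L2_set_def using bound[OF that] by (intro real_le_lsqrt) auto
  from l2I[OF this] show "T (glue c) \<in> l2" "l2norm (T (glue c)) \<le> 2 * (1 / 2) ^ n" by auto
qed

text \<open>Truncating \<open>c\<close> gives finitely supported sequences whose images approximate
  \<open>T (glue c)\<close> up to a geometric tail. So this image is in the closure of the range,
  whether or not \<open>glue c\<close> is in \<open>l2\<close>.\<close>

lemma T_glue_in_range:
  assumes closed: "l2_closed (T ` l2)" and c: "\<And>k. cmod (c k) \<le> 1"
  shows "T (glue c) \<in> T ` l2"
proof -
  have "\<exists>h\<in>T ` l2. l2norm (\<lambda>x. h x - T (glue c) x) < e" if e: "e > 0" for e
  proof -
    have "(\<lambda>n. 2 * (1 / 2 :: real) ^ n) \<longlonglongrightarrow> 2 * 0" by (intro tendsto_intros LIMSEQ_power_zero) simp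
    then have "\<forall>\<^sub>F n in sequentially. 2 * (1 / 2 :: real) ^ n < e"
      using e by (intro order_tendstoD(2)) auto
    then obtain n where n: "2 * (1 / 2 :: real) ^ n < e" by (auto simp: eventually_sequentially)
    define c1 where "c1 k = (if k < n then c k else 0)" for k
    define c2 where "c2 k = (if k < n then 0 else - c k)" for k
    have "glue c1 \<in> l2" by (rule glue_finite[of n]) (simp add: c1_def)
    moreover have "(\<lambda>x. T (glue c1) x - T (glue c) x) = T (glue c2)"
      by (auto simp: T_glue c1_def c2_def)
    moreover have "l2norm (T (glue c2)) \<le> 2 * (1 / 2) ^ n"
      by (rule l2norm_T_glue) (auto simp: c2_def c)
    ultimately show ?thesis using n by (intro bexI[of _ "T (glue c1)"]) auto
  qed
  moreover have "T (glue c) \<in> l2" by (rule T_glue_l2[of _ 0]) (auto simp: c)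
  ultimately show ?thesis using closed unfolding l2_closed_def by blast
qed

text \<open>Each hump beyond \<open>N\<close> with a coefficient of modulus at least
  \<open>r\<close> contributes at least \<open>r^2\<close> to the squared norm of \<open>h\<close>,
  and there are infinitely many of them with disjoint supports.\<close>

lemma glue_not_eventually_l2:
  assumes "h \<in> l2" "\<And>x. x \<ge> N \<Longrightarrow> glue c x = h x" "r > 0" "infinite {k. r \<le> cmod (c k)}"
  shows False
proof -
  \<comment> \<open>By \<open>supp_ge\<close>, discarding the indices below \<open>nat N\<close>
    leaves only humps in the region where \<open>glue c\<close> and \<open>h\<close> agree.\<close>
  have "infinite ({k. r \<le> cmod (c k)} - {..<nat N})" using assms(4) by simp
  moreover obtain n :: nat where n: "(l2norm h)\<^sup>2 / r\<^sup>2 < real n" using reals_Archimedean2 by blast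
  ultimately obtain A where A: "finite A" "card A = n" "A \<subseteq> {k. r \<le> cmod (c k)} - {..<nat N}"
    using infinite_arbitrarily_large by blast
  define S where "S k = {x. f k x \<noteq> 0}" for k
  have S: "finite (S k)" for k using finite_supp by (simp add: S_def)
  have "real n * r\<^sup>2 = (\<Sum>k\<in>A. r\<^sup>2 * (l2norm (f k))\<^sup>2)" by (simp add: A norm_f)
  also have "\<dots> = (\<Sum>k\<in>A. r\<^sup>2 * (\<Sum>x\<in>S k. (cmod (f k x))\<^sup>2))"
    by (intro sum.cong refl arg_cong2[of _ _ _ _ "(*)"] l2_finite_support(2) S) (auto simp: S_def)
  also have "\<dots> \<le> (\<Sum>k\<in>A. \<Sum>x\<in>S k. (cmod (h x))\<^sup>2)"
    unfolding sum_distrib_left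
  proof (intro sum_mono)
    fix k x assume k: "k \<in> A" and x: "x \<in> S k"
    have "N \<le> x" using supp_ge[of k x] x k A(3) by (force simp: S_def)
    then have "h x = c k * f k x"
      using assms(2)[of x] supp_index[of k x] x by (simp add: S_def glue_def)
    moreover have "r\<^sup>2 \<le> (cmod (c k))\<^sup>2" using k A(3) assms(3) by (intro power_mono) auto
    ultimately show "r\<^sup>2 * (cmod (f k x))\<^sup>2 \<le> (cmod (h x))\<^sup>2"
      by (simp add: norm_mult power_mult_distrib mult_right_mono)
  qed
  also have "\<dots> = (\<Sum>x\<in>(\<Union>k\<in>A. S k). (cmod (h x))\<^sup>2)"
    by (rule sum.UNION_disjoint[symmetric]) (use A S in \<open>auto simp: S_def dest!: supp_index\<close>)
  also have "\<dots> = (L2_set (\<lambda>x. cmod (h x)) (\<Union>k\<in>A. S k))\<^sup>2"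
    by (simp add: L2_set_def sum_nonneg)
  also have "\<dots> \<le> (l2norm h)\<^sup>2"
    by (intro power_mono L2_set_le_l2norm assms) (use A S in auto)
  finally have "real n * r\<^sup>2 \<le> (l2norm h)\<^sup>2" .
  then show False using n assms(3) by (simp add: field_simps)
qed

end

text \<open>The cross product of \<open>a\<close> and \<open>b\<close> is a solution. If it
  vanishes, the two rows are proportional and a solution of one nonzero row serves both.\<close>

lemma linear_dependence_2x3:
  fixes a b :: "nat \<Rightarrow> complex"
  shows "\<exists>c. (\<exists>i<3. c i \<noteq> 0) \<and> (\<Sum>i<3. c i * a i) = 0 \<and> (\<Sum>i<3. c i * b i) = 0"
proof -
  have *: "\<exists>c. (\<exists>i<3. c i \<noteq> 0) \<and> (\<Sum>i<3. c i * a i) = 0 \<and> (\<Sum>i<3. c i * b i) = 0"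
    if "c0 \<noteq> 0 \<or> c1 \<noteq> 0 \<or> c2 \<noteq> 0" "c0 * a 0 + c1 * a 1 + c2 * a 2 = 0"
      "c0 * b 0 + c1 * b 1 + c2 * b 2 = 0" for c0 c1 c2
  proof (intro exI[of _ "\<lambda>i. if i = 0 then c0 else if i = 1 then c1 else c2"] conjI)
    show "\<exists>i<3. (if i = (0::nat) then c0 else if i = 1 then c1 else c2) \<noteq> 0"
      using that(1)
    proof (elim disjE)
      assume "c0 \<noteq> 0" then show ?thesis by (intro exI[of _ 0]) simp
    next
      assume "c1 \<noteq> 0" then show ?thesis by (intro exI[of _ 1]) simp
    next
      assume "c2 \<noteq> 0" then show ?thesis by (intro exI[of _ 2]) simp
    qed
  qed (use that(2,3) in \<open>simp_all add: numeral_3_eq_3 numeral_2_eq_2\<close>)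
  let ?p = "a 1 * b 2 - a 2 * b 1" and ?q = "a 2 * b 0 - a 0 * b 2" and ?r = "a 0 * b 1 - a 1 * b 0"
  show ?thesis
  proof (cases "?p = 0 \<and> ?q = 0 \<and> ?r = 0")
    case False
    then show ?thesis by (intro *[of ?p ?q ?r]) (auto simp: algebra_simps)
  next
    case True
    consider "a 0 \<noteq> 0 \<or> a 1 \<noteq> 0" | "a 0 = 0" "a 1 = 0" "a 2 \<noteq> 0" | "a 0 = 0" "a 1 = 0" "a 2 = 0" by blast
    then show ?thesis
    proof cases
      case 1
      then show ?thesis using True by (intro *[of "a 1" "- a 0" 0]) (auto simp: algebra_simps)
    next
      case 2
      then show ?thesis using True by (intro *[of 1 0 0]) auto
    next
      case 3
      show ?thesis
      proof (cases "b 0 = 0 \<and> b 1 = 0")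
        case True
        then show ?thesis using 3 by (intro *[of 1 0 0]) auto
      next
        case False
        then show ?thesis using 3 by (intro *[of "b 1" "- b 0" 0]) auto
      qed
    qed
  qed
qed

lemma tridiag_sum:
  "tridiag \<alpha> \<beta> \<gamma> (\<lambda>x. \<Sum>i<(n::nat). c i * u i x) x = (\<Sum>i<n. c i * tridiag \<alpha> \<beta> \<gamma> (u i) x)"
  by (induction n) (simp_all add: tridiag_def algebra_simps)

lemma l2_sum: "(\<And>i. i < (n::nat) \<Longrightarrow> u i \<in> l2) \<Longrightarrow> (\<lambda>x. \<Sum>i<n. c i * u i x) \<in> l2"
  by (induction n) (simp_all add: l2_add l2_scale)

text \<open>Gluing the humps along the three residue classes modulo 3 gives three elements of the
  closure of the range. Were they all in the range, three solutions of the second order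
  recurrence \<open>T u = 0\<close> would result; by linear dependence some combination of
  the glued humps, which is not square summable, would agree with an element of \<open>\<ell>\<^sup>2\<close>.\<close>

lemma (in bounded_tridiag) not_closed_range_if_symbol_zero:
  assumes lim: "(\<alpha> \<longlongrightarrow> \<alpha>0) at_top" "(\<beta> \<longlongrightarrow> \<beta>0) at_top" "(\<gamma> \<longlongrightarrow> \<gamma>0) at_top"
    and nz: "\<alpha>0 \<noteq> 0" and z: "cmod z = 1" and symbol: "\<alpha>0 * z + \<beta>0 / z + \<gamma>0 = 0"
  shows "\<not> l2_closed (T ` l2)"
proof
  assume closed: "l2_closed (T ` l2)"
  obtain f \<kappa> where "hump_sequence \<alpha> \<beta> \<gamma> K f \<kappa>"
    using hump_sequence_exists[OF lim z symbol] by blast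
  then interpret hump_sequence \<alpha> \<beta> \<gamma> K f \<kappa> .
  define d :: "nat \<Rightarrow> nat \<Rightarrow> complex" where "d i k = (if k mod 3 = i then 1 else 0)" for i k
  have "\<forall>i. \<exists>h. h \<in> l2 \<and> T (glue (d i)) = T h"
    using T_glue_in_range[OF closed, of "d i" for i] by (fastforce simp: d_def)
  then obtain h where h: "\<And>i. h i \<in> l2" "\<And>i. T (glue (d i)) = T (h i)" by metis
  define u where "u i x = glue (d i) x - h i x" for i x
  have Tu: "T (u i) x = 0" for i x
    using h(2)[of i] unfolding u_def[abs_def] tridiag_diff by simp
  have "\<forall>\<^sub>F x in at_top. \<alpha> x \<noteq> 0" using tendsto_imp_eventually_ne[OF lim(1) nz] .
  then obtain N where N: "\<And>x. x \<ge> N \<Longrightarrow> \<alpha> x \<noteq> 0" unfolding eventually_at_top_linorder by blast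
  \<comment> \<open>Beyond \<open>N\<close> a solution of \<open>T u = 0\<close> is determined by
    its values at \<open>N\<close> and \<open>N + 1\<close>, so three solutions are dependent
    there.\<close>
  obtain c where c: "\<exists>i<3. c i \<noteq> 0" "(\<Sum>i<3. c i * u i N) = 0" "(\<Sum>i<3. c i * u i (N + 1)) = 0"
    using linear_dependence_2x3[of "\<lambda>i. u i N" "\<lambda>i. u i (N + 1)"] by blast
  define U where "U x = (\<Sum>i<3. c i * u i x)" for x
  have TU: "T U x = 0" for x unfolding U_def[abs_def] tridiag_sum by (simp add: Tu)
  have "U (N + int n) = 0 \<and> U (N + int n + 1) = 0" for n
  proof (induction n)
    case (Suc n)
    have "\<alpha> (N + int n + 1) * U (N + int n + 1 + 1) = 0"
      using TU[of "N + int n + 1"] Suc by (simp add: tridiag_def)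
    then show ?case using N[of "N + int n + 1"] Suc by (simp add: algebra_simps)
  qed (use c in \<open>simp add: U_def\<close>)
  then have U0: "U x = 0" if "x \<ge> N" for x
    using that by (metis add_diff_cancel_left' diff_ge_0_iff_ge nonneg_int_cases diff_add_cancel add.commute)
  \<comment> \<open>Vanishing of \<open>U\<close> identifies the glued sequence, in which every
    \<open>c i\<close> recurs infinitely often, with a combination of the square summable
    \<open>h i\<close>.\<close>
  have "glue (\<lambda>k. c (k mod 3)) x = (\<Sum>i<3. c i * h i x)" if "x \<ge> N" for x
  proof -
    have "(\<Sum>i<3. c i * glue (d i) x) = glue (\<lambda>k. c (k mod 3)) x"
    proof -
      have "(\<Sum>i<3. c i * d i k) = c (k mod 3)" for k
        by (simp add: d_def if_distrib[of "\<lambda>y. _ * y"] cong: if_cong)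
      then show ?thesis by (simp add: glue_def sum_distrib_right[symmetric] mult.assoc[symmetric])
    qed
    moreover have "(\<Sum>i<3. c i * glue (d i) x) - (\<Sum>i<3. c i * h i x) = U x"
      by (simp add: U_def u_def right_diff_distrib sum_subtractf)
    ultimately show ?thesis using U0[OF that] by simp
  qed
  moreover have "(\<lambda>x. \<Sum>i<3. c i * h i x) \<in> l2" by (rule l2_sum) (rule h)
  moreover obtain i where i: "i < 3" "c i \<noteq> 0" using c(1) by blast
  moreover have "infinite {k. cmod (c i) \<le> cmod (c (k mod 3))}"
  proof -
    have "range (\<lambda>n. 3 * n + i) \<subseteq> {k. cmod (c i) \<le> cmod (c (k mod 3))}" using i by auto
    moreover have "infinite (range (\<lambda>n. 3 * n + i))" by (intro range_inj_infinite injI) simp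
    ultimately show ?thesis using finite_subset by blast
  qed
  ultimately show False using glue_not_eventually_l2[of "\<lambda>x. \<Sum>i<3. c i * h i x" N _ "cmod (c i)"]
    by auto
qed

section \<open>Split-step quantum walks\<close>

text \<open>Reflection is a norm-preserving bijection of \<open>l2\<close> that conjugates the two
  operators.\<close>

lemma l2_closed_range_reflect:
  assumes "l2_closed (tridiag \<alpha> \<beta> \<gamma> ` l2)"
  shows "l2_closed (tridiag (\<lambda>x. \<beta> (- x)) (\<lambda>x. \<alpha> (- x)) (\<lambda>x. \<gamma> (- x)) ` l2)"
    (is "l2_closed (?T' ` l2)")
  unfolding l2_closed_def
proof (intro ballI impI)
  let ?T = "tridiag \<alpha> \<beta> \<gamma>"
  have reflect: "?T' f = (\<lambda>x. ?T (\<lambda>x. f (- x)) (- x))" for f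
    by (rule ext) (simp add: tridiag_reflect)
  fix g assume g: "g \<in> l2" and approx: "\<forall>e>0. \<exists>h\<in>?T' ` l2. l2norm (\<lambda>x. h x - g x) < e"
  have g': "(\<lambda>x. g (- x)) \<in> l2" using g by (simp add: l2_uminus)
  have "\<exists>h\<in>?T ` l2. l2norm (\<lambda>x. h x - g (- x)) < e" if e: "e > 0" for e
  proof -
    obtain f where f: "f \<in> l2" "l2norm (\<lambda>x. ?T' f x - g x) < e" using approx e by blast
    have "l2norm (\<lambda>x. ?T' f x - g x) = l2norm (\<lambda>x. ?T (\<lambda>x. f (- x)) x - g (- x))"
      using l2norm_uminus[of "\<lambda>x. ?T (\<lambda>x. f (- x)) x - g (- x)"] by (simp add: reflect)
    moreover have "(\<lambda>x. f (- x)) \<in> l2" using f by (simp add: l2_uminus)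
    ultimately show ?thesis using f by auto
  qed
  then obtain k where k: "k \<in> l2" "(\<lambda>x. g (- x)) = ?T k"
    using assms[unfolded l2_closed_def, THEN bspec, OF g'] by blast
  have "g = ?T' (\<lambda>x. k (- x))"
  proof
    fix x
    show "g x = ?T' (\<lambda>x. k (- x)) x"
      using fun_cong[OF k(2), of "- x"] by (simp add: reflect)
  qed
  moreover have "(\<lambda>x. k (- x)) \<in> l2" using k by (simp add: l2_uminus)
  ultimately show "g \<in> ?T' ` l2" by blast
qed

lemma filterlim_int_shift:
  "filterlim (\<lambda>x::int. x + k) at_top at_top" "filterlim (\<lambda>x::int. x + k) at_bot at_bot"
proof -
  show "filterlim (\<lambda>x::int. x + k) at_top at_top"
    unfolding filterlim_at_top eventually_at_top_linorder
    by (intro allI, rule_tac x = "Z - k" in exI) auto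
  show "filterlim (\<lambda>x::int. x + k) at_bot at_bot"
    unfolding filterlim_at_bot eventually_at_bot_linorder
    by (intro allI, rule_tac x = "Z - k" in exI) auto
qed

lemma filterlim_int_uminus: "filterlim (uminus :: int \<Rightarrow> int) at_bot at_top"
  unfolding filterlim_at_bot eventually_at_top_linorder
  by (intro allI, rule_tac x = "- Z" in exI) auto

section \<open>Coefficients of the walk operator and zeros of its symbol\<close>

text \<open>The argument is a value of the coin entry and not a site, so the same expression serves
  for the operator at \<open>x\<close> and for its limits.\<close>

definition raising_coeff :: "real \<Rightarrow> complex \<Rightarrow> complex \<Rightarrow> complex" where
  "raising_coeff p q b = complex_of_real (1 + p) * cis (Arg q) * b / (- 2 * \<i>)"

definition lowering_coeff :: "real \<Rightarrow> complex \<Rightarrow> complex \<Rightarrow> complex" where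
  "lowering_coeff p q b = - complex_of_real (1 - p) * cis (- Arg q) * cnj b / (- 2 * \<i>)"

definition diagonal_coeff :: "complex \<Rightarrow> real \<Rightarrow> complex" where
  "diagonal_coeff q a = complex_of_real (cmod q * a) / (- 2 * \<i>)"

lemma Qeps_plus_tridiag:
  "Qeps_plus p q a1 a2 b = tridiag (\<lambda>x. raising_coeff p q (b (x + 1))) (\<lambda>x. lowering_coeff p q (b x))
     (\<lambda>x. diagonal_coeff q (a2 (x + 1) - a1 x))"
  by (intro ext) (simp add: Qeps_plus_def tridiag_def raising_coeff_def lowering_coeff_def
      diagonal_coeff_def Lshift_def Lshift_adj_def field_simps)

text \<open>On the unit circle \<open>1 / z\<close> is the conjugate of \<open>z\<close>, which
  turns the lowering term into a multiple of \<open>cnj w\<close>.\<close>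

lemma symbol_eq:
  assumes "cmod z = 1" and w: "w = cis (Arg q) * b * z"
  shows "raising_coeff p q b * z + lowering_coeff p q b / z + diagonal_coeff q (a2 - a1)
    = (of_real (1 + p) * w - of_real (1 - p) * cnj w + of_real (cmod q * (a2 - a1))) / (- 2 * \<i>)"
proof -
  have "inverse z = cnj z" using complex_norm_square[of z] assms(1) by (intro inverse_unique) simp
  then have cw: "cnj w = cis (- Arg q) * cnj b / z"
    by (simp only: w complex_cnj_mult cis_cnj divide_inverse)
  show ?thesis
    unfolding cw unfolding w raising_coeff_def lowering_coeff_def diagonal_coeff_def divide_inverse
    by (simp only: distrib_left distrib_right left_diff_distrib right_diff_distrib
        mult_minus_left minus_mult_right[symmetric] mult.assoc mult.commute mult.left_commute
        diff_conv_add_uminus)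
qed

text \<open>With \<open>w = e\<^bsup>i\<theta>\<^esup> b z\<close> the symbol is proportional to
  \<open>p Re w + i Im w - \<bar>q\<bar> a\<close>, so it vanishes iff \<open>w\<close> is real and \<open>p w = \<bar>q\<bar> a\<close>.\<close>

lemma symbol_zero_iff:
  assumes pq: "p\<^sup>2 + (cmod q)\<^sup>2 = 1" and unit: "a1\<^sup>2 + (cmod b)\<^sup>2 = 1"
    and orth: "b * complex_of_real (a1 + a2) = 0" and b: "b \<noteq> 0"
  shows "(\<exists>z. cmod z = 1 \<and> raising_coeff p q b * z + lowering_coeff p q b / z
      + diagonal_coeff q (a2 - a1) = 0) \<longleftrightarrow> \<bar>p\<bar> = \<bar>a1\<bar>"
proof
  have a2: "a2 = - a1" using orth b by (simp add: of_real_eq_0_iff flip: of_real_add) 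
  {
    assume "\<exists>z. cmod z = 1 \<and> raising_coeff p q b * z + lowering_coeff p q b / z
      + diagonal_coeff q (a2 - a1) = 0"
    then obtain z where z: "cmod z = 1" and
      0: "raising_coeff p q b * z + lowering_coeff p q b / z + diagonal_coeff q (a2 - a1) = 0" by blast
    define w where "w = cis (Arg q) * b * z"
    have w0: "of_real (1 + p) * w - of_real (1 - p) * cnj w + of_real (cmod q * (a2 - a1)) = 0"
      using 0 symbol_eq[OF z w_def] by simp
    have "Im w = 0" using arg_cong[OF w0, of Im] by (simp add: algebra_simps)
    moreover have pw: "p * Re w = cmod q * a1"
      using arg_cong[OF w0, of Re] a2 by (simp add: algebra_simps)
    moreover have "cmod w = cmod b" using z by (simp add: w_def norm_mult)
    ultimately have "(Re w)\<^sup>2 = (cmod b)\<^sup>2" using cmod_power2[of w] by simp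
    \<comment> \<open>Inserting both normalisations, \<open>p^2 (1 - a1^2) = (1 - p^2) a1^2\<close>,
      and the mixed terms cancel.\<close>
    then have "p\<^sup>2 * (cmod b)\<^sup>2 = (cmod q)\<^sup>2 * a1\<^sup>2" using pw by (metis power_mult_distrib)
    moreover have "(cmod b)\<^sup>2 = 1 - a1\<^sup>2" "(cmod q)\<^sup>2 = 1 - p\<^sup>2" using unit pq by auto
    ultimately have "p\<^sup>2 = a1\<^sup>2" by (simp add: algebra_simps)
    then show "\<bar>p\<bar> = \<bar>a1\<bar>" by (simp add: power2_eq_iff abs_eq_iff)
  next
    assume pa: "\<bar>p\<bar> = \<bar>a1\<bar>"
    then have "p\<^sup>2 = a1\<^sup>2" by (metis power2_abs)
    then have "(cmod b)\<^sup>2 = (cmod q)\<^sup>2" using unit pq by linarith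
    then have bq: "cmod b = cmod q" by simp
    \<comment> \<open>The real value that \<open>w\<close> must take: its modulus is
      \<open>cmod b = cmod q\<close>, and the sign gives \<open>p * s = cmod q * a1\<close>. The
      point \<open>z\<close> is then solved from \<open>w\<close>.\<close>
    define s :: real where "s = (if p = a1 then cmod b else - cmod b)"
    have ps: "p * s = cmod q * a1" using pa by (auto simp: s_def bq abs_eq_iff)
    define z where "z = of_real s / (cis (Arg q) * b)"
    have z: "cmod z = 1" using b by (simp add: z_def s_def norm_divide norm_mult)
    have w: "of_real s = cis (Arg q) * b * z" using b by (simp add: z_def)
    have "of_real (1 + p) * of_real s - of_real (1 - p) * cnj (of_real s) + of_real (cmod q * (a2 - a1)) = (0 :: complex)"
      using ps a2 by (simp add: complex_eq_iff algebra_simps)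
    then show "\<exists>z. cmod z = 1 \<and> raising_coeff p q b * z + lowering_coeff p q b / z
      + diagonal_coeff q (a2 - a1) = 0"
      using z by (intro exI[of _ z]) (simp only: symbol_eq[OF z w] div_0)
  }
qed

section \<open>Asymptotics of the coin at the two ends\<close>

locale split_step =
  fixes p :: real and q :: complex and a1 a2 :: "int \<Rightarrow> real" and b :: "int \<Rightarrow> complex"
  assumes q_ne: "q \<noteq> 0"
    and pq: "p\<^sup>2 + (cmod q)\<^sup>2 = 1"
    and unit1: "\<And>x. (a1 x)\<^sup>2 + (cmod (b x))\<^sup>2 = 1"
    and unit2: "\<And>x. (a2 x)\<^sup>2 + (cmod (b x))\<^sup>2 = 1"
    and orth: "\<And>x. b x * complex_of_real (a1 x + a2 x) = 0"
begin

abbreviation "up \<equiv> \<lambda>x. raising_coeff p q (b (x + 1))"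
abbreviation "low \<equiv> \<lambda>x. lowering_coeff p q (b x)"
abbreviation "dg \<equiv> \<lambda>x. diagonal_coeff q (a2 (x + 1) - a1 x)"

lemma abs_p_less_1: "\<bar>p\<bar> < 1"
proof -
  have "0 < (cmod q)\<^sup>2" using q_ne by simp
  then have "p\<^sup>2 < 1" using pq by linarith
  then show ?thesis by (simp add: abs_square_less_1)
qed

lemma coeff_bounded: "cmod (up x) \<le> 1" "cmod (low x) \<le> 1" "cmod (dg x) \<le> 1"
proof -
  have sq: "\<bar>s\<bar> \<le> 1" if "s\<^sup>2 + t\<^sup>2 = 1" for s t :: real
    using that zero_le_power2[of t] unfolding abs_square_le_1[symmetric] by linarith
  have b1: "cmod (b y) \<le> 1" for y using sq[of "cmod (b y)" "a1 y"] unit1[of y] by (simp add: add.commute)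
  have a: "\<bar>a1 y\<bar> \<le> 1" "\<bar>a2 y\<bar> \<le> 1" for y using sq unit1 unit2 by blast+
  have q1: "cmod q \<le> 1" using sq[of "cmod q" p] pq by (simp add: add.commute)
  have "cmod (up x) = (1 + p) / 2 * cmod (b (x + 1))"
    using abs_p_less_1 by (simp add: raising_coeff_def norm_mult norm_divide del: of_real_add)
  also have "\<dots> \<le> 1 * 1" using abs_p_less_1 b1 by (intro mult_mono) auto
  finally show "cmod (up x) \<le> 1" by simp
  have "cmod (low x) = (1 - p) / 2 * cmod (b x)"
    using abs_p_less_1 by (simp add: lowering_coeff_def norm_mult norm_divide del: of_real_diff)
  also have "\<dots> \<le> 1 * 1" using abs_p_less_1 b1 by (intro mult_mono) auto
  finally show "cmod (low x) \<le> 1" by simp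
  have "cmod (dg x) = cmod q * (\<bar>a2 (x + 1) - a1 x\<bar> / 2)"
    by (simp add: diagonal_coeff_def norm_mult norm_divide abs_mult del: of_real_mult of_real_diff)
  also have "\<dots> \<le> 1 * 1" using q1 a(2)[of "x + 1"] a(1)[of x] by (intro mult_mono) auto
  finally show "cmod (dg x) \<le> 1" by simp
qed

sublocale bounded_tridiag up low dg 1
  by unfold_locales (rule coeff_bounded)+

sublocale reflected: bounded_tridiag "\<lambda>x. low (- x)" "\<lambda>x. up (- x)" "\<lambda>x. dg (- x)" 1
  by unfold_locales (rule coeff_bounded)+

lemma coeff_zero_iff: "raising_coeff p q \<beta> = 0 \<longleftrightarrow> \<beta> = 0" "lowering_coeff p q \<beta> = 0 \<longleftrightarrow> \<beta> = 0"
proof -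
  have "complex_of_real (1 + p) \<noteq> 0" "complex_of_real (1 - p) \<noteq> 0"
    unfolding of_real_eq_0_iff using abs_p_less_1 by auto
  then show "raising_coeff p q \<beta> = 0 \<longleftrightarrow> \<beta> = 0" "lowering_coeff p q \<beta> = 0 \<longleftrightarrow> \<beta> = 0"
    unfolding raising_coeff_def lowering_coeff_def by simp_all
qed

text \<open>The filter \<open>F\<close> stands for either end. Its invariance under the shift is
  required because the coefficients at \<open>x\<close> involve \<open>b (x + 1)\<close> and
  \<open>a2 (x + 1)\<close>.\<close>

context
  fixes F :: "int filter" and s1 s2 :: real and \<beta> :: complex
  assumes nontriv: "F \<noteq> bot" and shift: "filterlim (\<lambda>x. x + 1) F F"
    and lim1: "(a1 \<longlongrightarrow> s1) F" and lim2: "(a2 \<longlongrightarrow> s2) F" and limb: "(b \<longlongrightarrow> \<beta>) F"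
begin

lemma limit_relations: "s1\<^sup>2 + (cmod \<beta>)\<^sup>2 = 1" "s2\<^sup>2 + (cmod \<beta>)\<^sup>2 = 1" "\<beta> * complex_of_real (s1 + s2) = 0"
proof -
  have "((\<lambda>x. (a1 x)\<^sup>2 + (cmod (b x))\<^sup>2) \<longlongrightarrow> s1\<^sup>2 + (cmod \<beta>)\<^sup>2) F"
    by (intro tendsto_intros lim1 limb)
  then show "s1\<^sup>2 + (cmod \<beta>)\<^sup>2 = 1" using unit1 by (simp add: tendsto_const_iff[OF nontriv])
  have "((\<lambda>x. (a2 x)\<^sup>2 + (cmod (b x))\<^sup>2) \<longlongrightarrow> s2\<^sup>2 + (cmod \<beta>)\<^sup>2) F"
    by (intro tendsto_intros lim2 limb)
  then show "s2\<^sup>2 + (cmod \<beta>)\<^sup>2 = 1" using unit2 by (simp add: tendsto_const_iff[OF nontriv])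
  have "((\<lambda>x. b x * complex_of_real (a1 x + a2 x)) \<longlongrightarrow> \<beta> * complex_of_real (s1 + s2)) F"
    by (intro tendsto_intros lim1 lim2 limb)
  then show "\<beta> * complex_of_real (s1 + s2) = 0"
    unfolding orth tendsto_const_iff[OF nontriv] by simp
qed

lemma coeff_limits:
  "(up \<longlongrightarrow> raising_coeff p q \<beta>) F" "(low \<longlongrightarrow> lowering_coeff p q \<beta>) F"
  "(dg \<longlongrightarrow> diagonal_coeff q (s2 - s1)) F"
  unfolding raising_coeff_def lowering_coeff_def diagonal_coeff_def
  by (intro tendsto_intros filterlim_compose[OF limb shift] filterlim_compose[OF lim2 shift] lim1 limb; simp)+

text \<open>Here \<open>a1 + a2\<close> tends to \<open>2 * s1\<close>, which is nonzero, so
  \<open>orth\<close> forces \<open>b\<close> to vanish exactly near the end. The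
  \<open>a1 x\<close> and \<open>a2 x\<close> are then signs, fixed by their limits.\<close>

lemma eventually_zero_coeffs:
  assumes "\<beta> = 0" "s1 = s2"
  shows "\<forall>\<^sub>F x in F. b x = 0 \<and> a1 x = s1 \<and> a2 x = s1"
proof -
  have s: "s1\<^sup>2 = 1" using limit_relations(1) assms by simp
  then have s0: "s1 \<noteq> 0" by auto
  have "((\<lambda>x. a1 x + a2 x) \<longlongrightarrow> s1 + s2) F" by (intro tendsto_intros lim1 lim2)
  then have "\<forall>\<^sub>F x in F. a1 x + a2 x \<noteq> 0"
    by (rule tendsto_imp_eventually_ne) (use assms s0 in auto)
  moreover have "\<forall>\<^sub>F x in F. a1 x \<noteq> - s1"
    by (rule tendsto_imp_eventually_ne[OF lim1]) (use s0 in auto)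
  moreover have "\<forall>\<^sub>F x in F. a2 x \<noteq> - s1"
    by (rule tendsto_imp_eventually_ne[OF lim2]) (use s0 assms in auto)
  ultimately show ?thesis
  proof eventually_elim
    case (elim x)
    have "complex_of_real (a1 x + a2 x) \<noteq> 0" using elim(1) unfolding of_real_eq_0_iff .
    then have b0: "b x = 0" using orth[of x] by simp
    then have "(a1 x)\<^sup>2 = s1\<^sup>2" "(a2 x)\<^sup>2 = s1\<^sup>2" using unit1[of x] unit2[of x] s by auto
    then show ?case using b0 elim by (auto simp: power2_eq_iff)
  qed
qed

text \<open>For \<open>\<beta> \<noteq> 0\<close> this is \<open>symbol_zero_iff\<close>. For
  \<open>\<beta> = 0\<close> the limits are signs: if they differ, the symbol is a nonzero constant;
  if they agree, all coefficients vanish near the end.\<close>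

lemma regular_cases:
  assumes "\<beta> \<noteq> 0 \<longrightarrow> \<bar>p\<bar> \<noteq> \<bar>s1\<bar>"
  obtains "\<And>z. cmod z = 1 \<Longrightarrow> raising_coeff p q \<beta> * z + lowering_coeff p q \<beta> / z + diagonal_coeff q (s2 - s1) \<noteq> 0"
  | "\<forall>\<^sub>F x in F. b x = 0 \<and> b (x + 1) = 0 \<and> dg x = 0"
proof (cases "\<beta> = 0")
  case False
  then show ?thesis using symbol_zero_iff[OF pq limit_relations(1,3)] assms that(1) by blast
next
  case True
  then have s: "s1\<^sup>2 = 1" "s2\<^sup>2 = 1" using limit_relations by auto
  show ?thesis
  proof (cases "s1 = s2")
    case True
    then have ev: "\<forall>\<^sub>F x in F. b x = 0 \<and> a1 x = s1 \<and> a2 x = s1"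
      using eventually_zero_coeffs \<open>\<beta> = 0\<close> by blast
    have "\<forall>\<^sub>F x in F. b (x + 1) = 0 \<and> a1 (x + 1) = s1 \<and> a2 (x + 1) = s1"
      using filterlim_iff[THEN iffD1, OF shift, rule_format, OF ev] .
    with ev have "\<forall>\<^sub>F x in F. b x = 0 \<and> b (x + 1) = 0 \<and> dg x = 0"
      by eventually_elim (simp add: diagonal_coeff_def)
    then show ?thesis by (rule that(2))
  next
    case False
    then have "complex_of_real (cmod q * (s2 - s1)) \<noteq> 0" using q_ne unfolding of_real_eq_0_iff by simp
    then have "diagonal_coeff q (s2 - s1) \<noteq> 0" unfolding diagonal_coeff_def by simp
    then show ?thesis using \<open>\<beta> = 0\<close>
      by (intro that(1)) (simp add: raising_coeff_def lowering_coeff_def)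
  qed
qed

end

lemma regular_right:
  assumes lim: "(a1 \<longlongrightarrow> s1) at_top" "(a2 \<longlongrightarrow> s2) at_top" "(b \<longlongrightarrow> \<beta>) at_top"
    and "\<beta> \<noteq> 0 \<longrightarrow> \<bar>p\<bar> \<noteq> \<bar>s1\<bar>"
  shows "regular_at_top up low dg"
proof (rule regular_cases[OF _ filterlim_int_shift(1) lim assms(4)])
  assume "\<And>z. cmod z = 1 \<Longrightarrow> raising_coeff p q \<beta> * z + lowering_coeff p q \<beta> / z + diagonal_coeff q (s2 - s1) \<noteq> 0"
  then show ?thesis
    by (intro regular_at_top_symbol[OF coeff_limits[OF _ filterlim_int_shift(1) lim]])
      (simp_all add: coeff_zero_iff)
next
  assume "\<forall>\<^sub>F x in at_top. b x = 0 \<and> b (x + 1) = 0 \<and> dg x = 0"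
  then show ?thesis
    by (intro regular_at_top_zero_columns, elim eventually_mono) (simp add: coeff_zero_iff)
qed simp

lemma reflected_limits:
  assumes lim: "(a1 \<longlongrightarrow> s1) at_bot" "(a2 \<longlongrightarrow> s2) at_bot" "(b \<longlongrightarrow> \<beta>) at_bot"
  shows "((\<lambda>x. low (- x)) \<longlongrightarrow> lowering_coeff p q \<beta>) at_top"
    "((\<lambda>x. up (- x)) \<longlongrightarrow> raising_coeff p q \<beta>) at_top"
    "((\<lambda>x. dg (- x)) \<longlongrightarrow> diagonal_coeff q (s2 - s1)) at_top"
proof -
  note limits = coeff_limits[OF trivial_limit_at_bot_linorder filterlim_int_shift(2) lim]
  show "((\<lambda>x. low (- x)) \<longlongrightarrow> lowering_coeff p q \<beta>) at_top"
    by (rule filterlim_compose[OF limits(2) filterlim_int_uminus])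
  show "((\<lambda>x. up (- x)) \<longlongrightarrow> raising_coeff p q \<beta>) at_top"
    by (rule filterlim_compose[OF limits(1) filterlim_int_uminus])
  show "((\<lambda>x. dg (- x)) \<longlongrightarrow> diagonal_coeff q (s2 - s1)) at_top"
    by (rule filterlim_compose[OF limits(3) filterlim_int_uminus])
qed

lemma regular_left:
  assumes lim: "(a1 \<longlongrightarrow> s1) at_bot" "(a2 \<longlongrightarrow> s2) at_bot" "(b \<longlongrightarrow> \<beta>) at_bot"
    and "\<beta> \<noteq> 0 \<longrightarrow> \<bar>p\<bar> \<noteq> \<bar>s1\<bar>"
  shows "regular_at_top (\<lambda>x. low (- x)) (\<lambda>x. up (- x)) (\<lambda>x. dg (- x))"
proof (rule regular_cases[OF _ filterlim_int_shift(2) lim assms(4)])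
  assume symbol: "\<And>z. cmod z = 1 \<Longrightarrow> raising_coeff p q \<beta> * z + lowering_coeff p q \<beta> / z + diagonal_coeff q (s2 - s1) \<noteq> 0"
  show ?thesis
  proof (rule reflected.regular_at_top_symbol[OF reflected_limits[OF lim]])
    \<comment> \<open>Reflection exchanges the off-diagonals, so its symbol at \<open>z\<close> is
      the original one at \<open>1 / z\<close>, again on the unit circle.\<close>
    fix z assume "cmod z = 1"
    then show "lowering_coeff p q \<beta> * z + raising_coeff p q \<beta> / z + diagonal_coeff q (s2 - s1) \<noteq> 0"
      using symbol[of "1 / z"] by (simp add: norm_divide add.commute)
  qed (simp add: coeff_zero_iff)
next
  assume "\<forall>\<^sub>F x in at_bot. b x = 0 \<and> b (x + 1) = 0 \<and> dg x = 0"
  from filterlim_iff[THEN iffD1, OF filterlim_int_uminus, rule_format, OF this]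
  have "\<forall>\<^sub>F x in at_top. b (- x) = 0 \<and> b (- x + 1) = 0 \<and> dg (- x) = 0" .
  then show ?thesis
    by (intro regular_at_top_zero_columns, elim eventually_mono) (simp add: coeff_zero_iff)
qed simp

lemma not_closed_right:
  assumes lim: "(a1 \<longlongrightarrow> s1) at_top" "(a2 \<longlongrightarrow> s2) at_top" "(b \<longlongrightarrow> \<beta>) at_top"
    and "\<beta> \<noteq> 0" "\<bar>p\<bar> = \<bar>s1\<bar>"
  shows "\<not> l2_closed (T ` l2)"
proof -
  note rel = limit_relations[OF trivial_limit_at_top_linorder filterlim_int_shift(1) lim]
  obtain z where "cmod z = 1" "raising_coeff p q \<beta> * z + lowering_coeff p q \<beta> / z + diagonal_coeff q (s2 - s1) = 0"
    using symbol_zero_iff[OF pq rel(1,3)] assms(4,5) by auto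
  then show ?thesis
    using assms(4) coeff_zero_iff(1)
    by (intro not_closed_range_if_symbol_zero[OF coeff_limits[OF _ filterlim_int_shift(1) lim]]) auto
qed

lemma not_closed_left:
  assumes lim: "(a1 \<longlongrightarrow> s1) at_bot" "(a2 \<longlongrightarrow> s2) at_bot" "(b \<longlongrightarrow> \<beta>) at_bot"
    and "\<beta> \<noteq> 0" "\<bar>p\<bar> = \<bar>s1\<bar>"
  shows "\<not> l2_closed (T ` l2)"
proof -
  note rel = limit_relations[OF trivial_limit_at_bot_linorder filterlim_int_shift(2) lim]
  obtain z where z: "cmod z = 1" "raising_coeff p q \<beta> * z + lowering_coeff p q \<beta> / z + diagonal_coeff q (s2 - s1) = 0"
    using symbol_zero_iff[OF pq rel(1,3)] assms(4,5) by auto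
  then have symbol: "lowering_coeff p q \<beta> * (1 / z) + raising_coeff p q \<beta> / (1 / z) + diagonal_coeff q (s2 - s1) = 0"
    by (simp add: add.commute)
  have unit: "cmod (1 / z) = 1" using z by (simp add: norm_divide)
  have nz: "lowering_coeff p q \<beta> \<noteq> 0" using assms(4) coeff_zero_iff(2) by blast
  have "\<not> l2_closed (reflected.T ` l2)"
    by (rule reflected.not_closed_range_if_symbol_zero[OF reflected_limits[OF lim] nz unit symbol])
  then show ?thesis using l2_closed_range_reflect by blast
qed

end

theorem theorem5p3:
  fixes p :: real and q :: complex
    and a1 a2 :: "int \<Rightarrow> real" and b :: "int \<Rightarrow> complex"
    and a1L a2L a1R a2R :: real and bL bR :: complex
  assumes q_ne: "q \<noteq> 0"
    and pq: "p\<^sup>2 + (cmod q)\<^sup>2 = 1"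
    and unit1: "\<And>x. (a1 x)\<^sup>2 + (cmod (b x))\<^sup>2 = 1"
    and unit2: "\<And>x. (a2 x)\<^sup>2 + (cmod (b x))\<^sup>2 = 1"
    and orth: "\<And>x. b x * complex_of_real (a1 x + a2 x) = 0"
    and limL1: "(a1 \<longlongrightarrow> a1L) at_bot" and limL2: "(a2 \<longlongrightarrow> a2L) at_bot"
    and limLb: "(b \<longlongrightarrow> bL) at_bot"
    and limR1: "(a1 \<longlongrightarrow> a1R) at_top" and limR2: "(a2 \<longlongrightarrow> a2R) at_top"
    and limRb: "(b \<longlongrightarrow> bR) at_top"
  shows "l2_closed (Qeps_plus p q a1 a2 b ` l2) \<longleftrightarrow>
           ((bL \<noteq> 0 \<longrightarrow> \<bar>p\<bar> \<noteq> \<bar>a1L\<bar>) \<and> (bR \<noteq> 0 \<longrightarrow> \<bar>p\<bar> \<noteq> \<bar>a1R\<bar>))"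
proof -
  interpret split_step p q a1 a2 b
    using q_ne pq unit1 unit2 orth by unfold_locales
  show ?thesis
    unfolding Qeps_plus_tridiag
    using closed_range_if_regular[OF regular_right[OF limR1 limR2 limRb] regular_left[OF limL1 limL2 limLb]]
      not_closed_right[OF limR1 limR2 limRb] not_closed_left[OF limL1 limL2 limLb]
    by blast
qed

end
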